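(* Let $z_0\in\mathbb{C}\setminus\Sigma(\mathcal{L})$ and $R>0$ be fixed, so that no pole of $\mathcal{S}$ lies on $\partial\mathcal{B}(z_0,R)$. Let $\overline{N}\in\mathbb{N}$ be the number of poles of $\mathcal{S}$ within $\mathcal{B}(z_0,R)$. Let $N^\star\in\mathbb{N}$ with $N^\star\geq\overline{N}$, and let $(M_k)_{k=1}^\infty\subset\mathbb{N}$ satisfy $M_k\geq N^\star-1$ and $M_{k+1}>M_k$ for all $k$. For $k=1,2,\ldots$, let $\mathcal{S}_{[M_k/N^\star]}$ be the $[M_k/N^\star]$ fast LS-Padé approximant of $\mathcal{S}$ centered at $z_0$, computed with $E=\max\{M_k,N^\star\}$. Then, for any $\delta>0$, there exist a constant $C''$ independent of $k$ and of $z$, and sets $\mathcal{E}_k\subset\mathbb{C}$ ($k=1,2,\ldots$) with Lebesgue measure $|\mathcal{E}_k|\leq\delta$, such that, for all $k$ and all $z\in\mathcal{B}(z_0,R)\setminus\mathcal{E}_k$, $$\left\|\mathcal{S}(z)-\mathcal{S}_{[M_k/N^\star]}(z)\right\|_V\leq C''\left|\frac{z-z_0}{\lambda_{N^\star+1}-z_0}\right|^{M_k}.$$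
   Context: Setting. $(V,\langle\cdot,\cdot\rangle_V)$ is a separable Hilbert space over $\mathbb{C}$ with induced norm $\|\cdot\|_V$. $\mathcal{L}:D(\mathcal{L})\subset V\to V$ is a bijective linear operator with dense domain $D(\mathcal{L})$, whose inverse $\mathcal{L}^{-1}:V\to V$ is compact and normal. $\Sigma(\mathcal{L})=\{\lambda\in\mathbb{C}:\exists v\in D(\mathcal{L})\setminus\{0\},\ \mathcal{L}v=\lambda v\}$ is its spectrum, and for $\lambda\in\Sigma(\mathcal{L})$, $P_\lambda$ is the $V$-orthogonal projection onto the eigenspace $\{v\in D(\mathcal{L}):\mathcal{L}v=\lambda v\}$. Fix $v^\star\in V$. For $z\in\mathbb{C}\setminus\Sigma(\mathcal{L})$, $\mathcal{S}(z)\in D(\mathcal{L})$ is the unique solution of $(\mathcal{L}-z\mathcal{I})\mathcal{S}(z)=v^\star$, where $\mathcal{I}$ is the identity; $\mathcal{S}$ is a meromorphic $V$-valued map and $\mathcal{S}(z)=\sum_{\lambda\in\Sigma(\mathcal{L})}\frac{P_\lambda v^\star}{\lambda-z}$. Standing assumptions. $\Sigma(\mathcal{L})$ is infinite (its only limit point is then $\infty$); $P_\lambda v^\star\neq0$ for all $\lambda\in\Sigma(\mathcal{L})$, so the poles of $\mathcal{S}$ are exactly the elements of $\Sigma(\mathcal{L})$. The (distinct) elements of $\Sigma(\mathcal{L})$ are enumerated as $\{\lambda_\alpha\}_{\alpha=1}^\infty$ with $|\lambda_\alpha-z_0|\leq|\lambda_{\alpha+1}-z_0|$ for all $\alpha\ge1$.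 Notation. $\mathcal{B}(z_0,R)=\{z\in\mathbb{C}:|z-z_0|<R\}$. For a function $F$ analytic near $z_0$ (scalar- or $V$-valued), $(F)_{\alpha,z_0}=\frac{1}{\alpha!}\frac{d^\alpha F}{dz^\alpha}(z_0)$ is its $\alpha$-th Taylor coefficient at $z_0$. $\mathbb{P}_N^{z_0}(\mathbb{C})$ is the set of polynomials $Q(z)=\sum_{j=0}^Nq_j(z-z_0)^j$ with $q_j\in\mathbb{C}$ and $\sum_{j=0}^N|q_j|^2=1$. The functional $\widetilde{j}_E:\mathbb{P}_N^{z_0}(\mathbb{C})\to[0,\infty)$ is $\widetilde{j}_E(Q)=\|(Q\mathcal{S})_{E,z_0}\|_V$. Fast LS-Padé approximant. For $E\geq\max\{M,N\}$, an $[M/N]$ fast LS-Padé approximant of $\mathcal{S}$ centered at $z_0$ with parameter $E$ is $\mathcal{S}_{[M/N]}=\mathcal{P}_{[M/N]}/Q_{[M/N]}$, where $Q_{[M/N]}\in\mathbb{P}_N^{z_0}(\mathbb{C})$ is a global minimizer of $\widetilde{j}_E$ and $\mathcal{P}_{[M/N]}(z)=\sum_{\alpha=0}^M(Q_{[M/N]}\mathcal{S})_{\alpha,z_0}(z-z_0)^\alpha$. *)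

theory Defs
  imports "HOL-Complex_Analysis.Complex_Analysis"
begin

text \<open>Complex Hilbert spaces; the inner product is linear in its first argument.\<close>

class complex_hilbert = banach +
  fixes scaleC :: "complex \<Rightarrow> 'a \<Rightarrow> 'a" (infixr \<open>*\<^sub>C\<close> 75)
    and cinner :: "'a \<Rightarrow> 'a \<Rightarrow> complex"
  assumes scaleC_add_right: "a *\<^sub>C (x + y) = a *\<^sub>C x + a *\<^sub>C y"
    and scaleC_add_left: "(a + b) *\<^sub>C x = a *\<^sub>C x + b *\<^sub>C x"
    and scaleC_scaleC: "a *\<^sub>C (b *\<^sub>C x) = (a * b) *\<^sub>C x"
    and scaleC_of_real: "complex_of_real r *\<^sub>C x = r *\<^sub>R x"
    and cinner_commute: "cinner x y = cnj (cinner y x)"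
    and cinner_add_left: "cinner (x + y) u = cinner x u + cinner y u"
    and cinner_scaleC_left: "cinner (a *\<^sub>C x) y = a * cinner x y"
    and cinner_nonneg: "0 \<le> Re (cinner x x)"
    and cinner_eq_zero_iff: "cinner x x = 0 \<longleftrightarrow> x = 0"
    and norm_eq_sqrt_cinner: "norm x = sqrt (Re (cinner x x))"

text \<open>An unbounded operator with domain \<open>D\<close> is a total function of which only the values
  on \<open>D\<close> matter.\<close>

definition complex_subspace :: "'v::complex_hilbert set \<Rightarrow> bool" where
  "complex_subspace D \<longleftrightarrow>
     0 \<in> D \<and> (\<forall>x\<in>D. \<forall>y\<in>D. x + y \<in> D) \<and> (\<forall>a. \<forall>x\<in>D. a *\<^sub>C x \<in> D)"

definition complex_linear_on :: "'v::complex_hilbert set \<Rightarrow> ('v \<Rightarrow> 'v) \<Rightarrow> bool" where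
  "complex_linear_on D L \<longleftrightarrow> complex_subspace D \<and>
     (\<forall>x\<in>D. \<forall>y\<in>D. L (x + y) = L x + L y) \<and> (\<forall>a. \<forall>x\<in>D. L (a *\<^sub>C x) = a *\<^sub>C L x)"

definition compact_operator :: "('v::complex_hilbert \<Rightarrow> 'v) \<Rightarrow> bool" where
  "compact_operator T \<longleftrightarrow>
     complex_linear_on UNIV T \<and> (\<forall>B. bounded B \<longrightarrow> compact (closure (T ` B)))"

text \<open>For a bounded linear \<open>T\<close> the function \<open>T'\<close> below exists and is unique: it is the Hilbert
  space adjoint of \<open>T\<close>.\<close>

definition normal_operator :: "('v::complex_hilbert \<Rightarrow> 'v) \<Rightarrow> bool" where
  "normal_operator T \<longleftrightarrow>
     (\<exists>T'. (\<forall>x y. cinner (T x) y = cinner x (T' y)) \<and> T \<circ> T' = T' \<circ> T)"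

definition eigenspace :: "'v::complex_hilbert set \<Rightarrow> ('v \<Rightarrow> 'v) \<Rightarrow> complex \<Rightarrow> 'v set" where
  "eigenspace D L l = {v \<in> D. L v = l *\<^sub>C v}"

definition spectrum :: "'v::complex_hilbert set \<Rightarrow> ('v \<Rightarrow> 'v) \<Rightarrow> complex set" where
  "spectrum D L = {l. \<exists>v \<in> D - {0}. L v = l *\<^sub>C v}"

definition orth_proj :: "'v::complex_hilbert set \<Rightarrow> 'v \<Rightarrow> 'v" where
  "orth_proj W v = (THE p. p \<in> W \<and> (\<forall>w\<in>W. cinner (v - p) w = 0))"

text \<open>Only meaningful for \<open>z \<notin> spectrum D L\<close>.\<close>

definition solution_map ::
    "'v::complex_hilbert set \<Rightarrow> ('v \<Rightarrow> 'v) \<Rightarrow> 'v \<Rightarrow> complex \<Rightarrow> 'v" where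
  "solution_map D L v z = (THE s. s \<in> D \<and> L s - z *\<^sub>C s = v)"

definition complex_deriv :: "(complex \<Rightarrow> 'v::complex_hilbert) \<Rightarrow> complex \<Rightarrow> 'v" where
  "complex_deriv F z = Lim (at z) (\<lambda>w. inverse (w - z) *\<^sub>C (F w - F z))"

definition taylor_coeff :: "(complex \<Rightarrow> 'v::complex_hilbert) \<Rightarrow> nat \<Rightarrow> complex \<Rightarrow> 'v" where
  "taylor_coeff F n z0 = (1 / fact n) *\<^sub>C (complex_deriv ^^ n) F z0"

definition unit_polys :: "nat \<Rightarrow> complex \<Rightarrow> (complex \<Rightarrow> complex) set" where
  "unit_polys N z0 =
     {Q. \<exists>q. Q = (\<lambda>z. \<Sum>j\<le>N. q j * (z - z0) ^ j) \<and> (\<Sum>j\<le>N. (cmod (q j))\<^sup>2) = 1}"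

definition fast_functional ::
    "(complex \<Rightarrow> 'v::complex_hilbert) \<Rightarrow> complex \<Rightarrow> nat \<Rightarrow> (complex \<Rightarrow> complex) \<Rightarrow> real" where
  "fast_functional S z0 E Q = norm (taylor_coeff (\<lambda>z. Q z *\<^sub>C S z) E z0)"

text \<open>Denominators need not be unique, so they are described by a predicate.\<close>

definition fast_LS_Pade_denominator ::
    "(complex \<Rightarrow> 'v::complex_hilbert) \<Rightarrow> complex \<Rightarrow> nat \<Rightarrow> nat \<Rightarrow> nat
     \<Rightarrow> (complex \<Rightarrow> complex) \<Rightarrow> bool" where
  "fast_LS_Pade_denominator S z0 M N E Q \<longleftrightarrow>
     max M N \<le> E \<and> is_arg_min (fast_functional S z0 E) (\<lambda>Q. Q \<in> unit_polys N z0) Q"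

definition fast_LS_Pade_numerator ::
    "(complex \<Rightarrow> 'v::complex_hilbert) \<Rightarrow> complex \<Rightarrow> nat \<Rightarrow> (complex \<Rightarrow> complex)
     \<Rightarrow> complex \<Rightarrow> 'v" where
  "fast_LS_Pade_numerator S z0 M Q z =
     (\<Sum>n\<le>M. (z - z0) ^ n *\<^sub>C taylor_coeff (\<lambda>w. Q w *\<^sub>C S w) n z0)"

text \<open>The approximant with denominator \<open>Q\<close>; only meaningful where \<open>Q z \<noteq> 0\<close>.\<close>

definition fast_LS_Pade ::
    "(complex \<Rightarrow> 'v::complex_hilbert) \<Rightarrow> complex \<Rightarrow> nat \<Rightarrow> (complex \<Rightarrow> complex)
     \<Rightarrow> complex \<Rightarrow> 'v" where
  "fast_LS_Pade S z0 M Q z = inverse (Q z) *\<^sub>C fast_LS_Pade_numerator S z0 M Q z"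

end

theory Submission
  imports Defs "HOL-Computational_Algebra.Fundamental_Theorem_Algebra"
begin

text \<open>Write \<open>w = z - z0\<close> and \<open>T = (L - z0)\<^sup>-\<^sup>1\<close>, and let \<open>Q = \<Sum>j\<le>N. q\<^sub>j w\<^sup>j\<close> with \<open>N \<le> M + 1\<close>.
  The finite expansion \<open>(L - z)\<^sup>-\<^sup>1 = \<Sum>i<m. w\<^sup>i T\<^sup>i\<^sup>+\<^sup>1 + w\<^sup>m (L - z)\<^sup>-\<^sup>1 T\<^sup>m\<close> of the resolvent
  shows that \<open>Q S\<close> minus its Taylor polynomial of degree \<open>M\<close> is
  \<open>w\<^sup>M\<^sup>+\<^sup>1 (L - z)\<^sup>-\<^sup>1 U\<close> with \<open>U = \<Sum>j\<le>N. q\<^sub>j T\<^sup>M\<^sup>+\<^sup>1\<^sup>-\<^sup>j v\<close>, where \<open>v\<close> is the right-hand side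
  of the equation (\<open>product_taylor_remainder\<close>). Dividing by \<open>Q z\<close> gives the error of the
  approximant. It remains to bound three factors.

  \<^item> The vector \<open>U\<close>. For \<open>N \<le> M\<close> it is the Taylor coefficient of \<open>Q S\<close> with index \<open>M\<close>, so its norm
    is the functional that \<open>Q\<close> minimises. For the polynomial proportional to
    \<open>\<Prod>i\<le>N. (w - (\<lambda>\<^sub>i - z0))\<close> it is a multiple of \<open>T\<^sup>M\<^sup>+\<^sup>1\<^sup>-\<^sup>N u\<close>, where \<open>u\<close> is orthogonal to the
    eigenspaces for \<open>\<lambda>\<^sub>1, \<dots>, \<lambda>\<^sub>N\<close> (\<open>annihilating_polynomial\<close>). On the vectors
    orthogonal to these eigenspaces the norm of \<open>T\<close> is at most \<open>1 / \<bar>\<lambda>\<^sub>N\<^sub>+\<^sub>1 - z0\<bar>\<close>, which gives the rate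
    of convergence (\<open>minimizer_remainder_vector_bound\<close>).
  \<^item> The resolvent. Its norm at \<open>z\<close> is at most the inverse of the distance from \<open>z\<close> to the spectrum
    (\<open>norm_resolvent_le\<close>).
  \<^item> The value \<open>1 / Q z\<close>. A normalised polynomial of degree at most \<open>N\<close> is bounded from below on a
    disc outside at most \<open>N\<close> small discs, with a bound that depends on \<open>N\<close> and the radii but not on
    the polynomial (\<open>poly_lower_bound_off_discs\<close>).

  The exceptional set is thus a union of small discs, around roots of \<open>Q\<close> and around the finitely
  many points of the spectrum near the ball; their number is bounded and their common radius is at
  our disposal.

  Both bounds on resolvents rest on one fact of spectral theory, \<open>norm_le_eigenvalue_bound\<close>: on a
  nonzero closed subspace that is invariant under a compact normal operator and its adjoint, the norm of the
  operator is attained at an eigenvector.\<close>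

section \<open>Complex Hilbert spaces\<close>

lemma scaleC_zero_left [simp]: "0 *\<^sub>C (x::'v::complex_hilbert) = 0"
  using scaleC_of_real[of 0 x] by simp

lemma scaleC_one [simp]: "1 *\<^sub>C (x::'v::complex_hilbert) = x"
  using scaleC_of_real[of 1 x] by simp

lemma scaleC_zero_right [simp]: "a *\<^sub>C (0::'v::complex_hilbert) = 0"
  using scaleC_scaleC[of a 0 0] by simp

lemma scaleC_minus_left [simp]: "(- a) *\<^sub>C (x::'v::complex_hilbert) = - (a *\<^sub>C x)"
  using scaleC_add_left[of a "-a" x] by (simp add: eq_neg_iff_add_eq_0 add.commute)

lemma scaleC_minus_right [simp]: "a *\<^sub>C (- x::'v::complex_hilbert) = - (a *\<^sub>C x)"
  using scaleC_add_right[of a x "-x"] by (simp add: eq_neg_iff_add_eq_0 add.commute)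

lemma scaleC_diff_left: "(a - b) *\<^sub>C (x::'v::complex_hilbert) = a *\<^sub>C x - b *\<^sub>C x"
  using scaleC_add_left[of a "-b" x] by simp

lemma scaleC_diff_right: "a *\<^sub>C (x - y::'v::complex_hilbert) = a *\<^sub>C x - a *\<^sub>C y"
  using scaleC_add_right[of a x "-y"] by simp

lemmas scaleC_algebra = scaleC_add_left scaleC_add_right scaleC_diff_left scaleC_diff_right

lemma scaleC_sum_right: "a *\<^sub>C (\<Sum>i\<in>I. f i :: 'v::complex_hilbert) = (\<Sum>i\<in>I. a *\<^sub>C f i)"
  by (induction I rule: infinite_finite_induct) (auto simp: scaleC_add_right)

lemma scaleC_sum_left: "(\<Sum>i\<in>I. f i) *\<^sub>C (x :: 'v::complex_hilbert) = (\<Sum>i\<in>I. f i *\<^sub>C x)"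
  by (induction I rule: infinite_finite_induct) (auto simp: scaleC_add_left)

lemma cinner_add_right: "cinner (x::'v::complex_hilbert) (y + u) = cinner x y + cinner x u"
  using cinner_commute[of x "y + u"] cinner_commute[of x y] cinner_commute[of x u]
  by (simp add: cinner_add_left)

lemma cinner_scaleC_right: "cinner (x::'v::complex_hilbert) (a *\<^sub>C y) = cnj a * cinner x y"
  using cinner_commute[of x "a *\<^sub>C y"] cinner_commute[of x y]
  by (simp add: cinner_scaleC_left)

lemma cinner_zero_left [simp]: "cinner 0 (x::'v::complex_hilbert) = 0"
  using cinner_scaleC_left[of 0 0 x] by simp

lemma cinner_zero_right [simp]: "cinner (x::'v::complex_hilbert) 0 = 0"
  using cinner_scaleC_right[of x 0 0] by simp

lemma cinner_minus_left: "cinner (- x) (y::'v::complex_hilbert) = - cinner x y"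
  using cinner_scaleC_left[of "-1" x y] by simp

lemma cinner_minus_right: "cinner x (- y::'v::complex_hilbert) = - cinner x y"
  using cinner_scaleC_right[of x "-1" y] by simp

lemma cinner_diff_left: "cinner (x - y) (u::'v::complex_hilbert) = cinner x u - cinner y u"
  using cinner_add_left[of x "-y" u] by (simp add: cinner_minus_left)

lemma cinner_diff_right: "cinner (u::'v::complex_hilbert) (x - y) = cinner u x - cinner u y"
  using cinner_add_right[of u x "-y"] by (simp add: cinner_minus_right)

lemmas cinner_algebra = cinner_add_left cinner_add_right cinner_diff_left cinner_diff_right
  cinner_scaleC_left cinner_scaleC_right

lemma cinner_self: "cinner x (x::'v::complex_hilbert) = of_real ((norm x)\<^sup>2)"
proof -
  have "Im (cinner x x) = 0"
    using cinner_commute[of x x] by (metis complex_cnj_cancel_iff Reals_cnj_iff complex_is_Real_iff)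
  moreover have "Re (cinner x x) = (norm x)\<^sup>2"
    using norm_eq_sqrt_cinner[of x] cinner_nonneg[of x] by simp
  ultimately show ?thesis by (simp add: complex_eq_iff)
qed

lemma norm_scaleC [simp]: "norm (a *\<^sub>C (x::'v::complex_hilbert)) = cmod a * norm x"
proof -
  have "complex_of_real ((norm (a *\<^sub>C x))\<^sup>2) = (a * cnj a) * of_real ((norm x)\<^sup>2)"
    unfolding cinner_self[symmetric] by (simp add: cinner_algebra)
  also have "\<dots> = of_real ((cmod a * norm x)\<^sup>2)"
    by (simp only: complex_norm_square [symmetric] power_mult_distrib of_real_mult)
  finally have "(norm (a *\<^sub>C x))\<^sup>2 = (cmod a * norm x)\<^sup>2"
    using of_real_eq_iff by blast
  then show ?thesis by simp
qed

lemma norm_diff_square: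
  "(norm (x - y::'v::complex_hilbert))\<^sup>2 = (norm x)\<^sup>2 - 2 * Re (cinner x y) + (norm y)\<^sup>2"
proof -
  have "Re (cinner (x - y) (x - y)) = Re (cinner x x) - 2 * Re (cinner x y) + Re (cinner y y)"
    using cinner_commute[of y x] by (simp add: cinner_algebra)
  then show ?thesis by (simp add: cinner_self)
qed

lemma cinner_Cauchy_Schwarz: "cmod (cinner x y) \<le> norm x * norm (y::'v::complex_hilbert)"
proof (cases "y = 0")
  case False
  define c where "c = cinner x y / of_real ((norm y)\<^sup>2)"
  have y: "norm y > 0" using False by simp
  have "0 \<le> (norm (x - c *\<^sub>C y))\<^sup>2" by simp
  also have "\<dots> = (norm x)\<^sup>2 - 2 * Re (cnj c * cinner x y) + (cmod c * norm y)\<^sup>2"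
    by (simp add: norm_diff_square cinner_algebra)
  also have "Re (cnj c * cinner x y) = (cmod (cinner x y))\<^sup>2 / (norm y)\<^sup>2"
  proof -
    have "cnj c * cinner x y = of_real ((cmod (cinner x y))\<^sup>2 / (norm y)\<^sup>2)"
      using complex_norm_square[of "cinner x y"] by (simp add: c_def mult.commute)
    then show ?thesis by simp
  qed
  also have "(cmod c * norm y)\<^sup>2 = (cmod (cinner x y))\<^sup>2 / (norm y)\<^sup>2"
  proof -
    have "cmod c = cmod (cinner x y) / (norm y)\<^sup>2"
      by (simp add: c_def norm_divide norm_power)
    then show ?thesis using y by (simp add: power2_eq_square)
  qed
  finally have "(cmod (cinner x y))\<^sup>2 / (norm y)\<^sup>2 \<le> (norm x)\<^sup>2" by simp
  then have "(cmod (cinner x y))\<^sup>2 \<le> (norm x * norm y)\<^sup>2"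
    using y by (simp add: divide_le_eq power_mult_distrib)
  then show ?thesis by (rule power2_le_imp_le) simp
qed simp

lemma bounded_bilinear_Re_cinner: "bounded_bilinear (\<lambda>x y::'v::complex_hilbert. Re (cinner x y))"
proof
  fix x y u v :: 'v and r :: real
  show "Re (cinner (x + y) u) = Re (cinner x u) + Re (cinner y u)" by (simp add: cinner_algebra)
  show "Re (cinner u (x + y)) = Re (cinner u x) + Re (cinner u y)" by (simp add: cinner_algebra)
  show "Re (cinner (r *\<^sub>R x) y) = r *\<^sub>R Re (cinner x y)"
    by (simp add: cinner_algebra flip: scaleC_of_real)
  show "Re (cinner x (r *\<^sub>R y)) = r *\<^sub>R Re (cinner x y)"
    by (simp add: cinner_algebra flip: scaleC_of_real)
  have "\<bar>Re (cinner a b)\<bar> \<le> norm a * norm b" for a b :: 'v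
    using cinner_Cauchy_Schwarz[of a b] abs_Re_le_cmod[of "cinner a b"] by linarith
  then show "\<exists>K. \<forall>a b::'v. norm (Re (cinner a b)) \<le> norm a * norm b * K"
    by (intro exI[of _ 1]) simp
qed

lemma bounded_bilinear_cinner: "bounded_bilinear (\<lambda>x y::'v::complex_hilbert. cinner x y)"
proof
  fix x y u v :: 'v and r :: real
  show "cinner (x + y) u = cinner x u + cinner y u" by (simp add: cinner_algebra)
  show "cinner u (x + y) = cinner u x + cinner u y" by (simp add: cinner_algebra)
  show "cinner (r *\<^sub>R x) y = r *\<^sub>R cinner x y"
    by (simp add: cinner_algebra scaleR_conv_of_real flip: scaleC_of_real)
  show "cinner x (r *\<^sub>R y) = r *\<^sub>R cinner x y"
    by (simp add: cinner_algebra scaleR_conv_of_real flip: scaleC_of_real)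
  show "\<exists>K. \<forall>a b::'v. norm (cinner a b) \<le> norm a * norm b * K"
    by (intro exI[of _ 1]) (simp add: cinner_Cauchy_Schwarz)
qed

lemma bounded_bilinear_scaleC: "bounded_bilinear (\<lambda>a (x::'v::complex_hilbert). a *\<^sub>C x)"
proof
  fix a b :: complex and x y :: 'v and r :: real
  show "(a + b) *\<^sub>C x = a *\<^sub>C x + b *\<^sub>C x" "a *\<^sub>C (x + y) = a *\<^sub>C x + a *\<^sub>C y"
    by (simp_all add: scaleC_algebra)
  show "(r *\<^sub>R a) *\<^sub>C x = r *\<^sub>R (a *\<^sub>C x)" "a *\<^sub>C (r *\<^sub>R x) = r *\<^sub>R (a *\<^sub>C x)"
    by (simp_all add: scaleC_scaleC scaleR_conv_of_real mult.commute flip: scaleC_of_real)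
  show "\<exists>K. \<forall>a (x::'v). norm (a *\<^sub>C x) \<le> norm a * norm x * K"
    by (intro exI[of _ 1]) simp
qed

lemmas tendsto_scaleC = bounded_bilinear.tendsto[OF bounded_bilinear_scaleC]

lemma cinner_left_eqI:
  assumes "\<And>x. cinner x y = cinner x (u::'v::complex_hilbert)" shows "y = u"
  using assms[of "y - u"] cinner_eq_zero_iff[of "y - u"] by (simp add: cinner_diff_right)

section \<open>Eigenvectors of compact normal operators\<close>

text \<open>The maximum of the quadratic form on the unit sphere is attained at an eigenvector: if
  \<open>a\<close> is the maximum, \<open>a * \<parallel>u\<parallel>\<^sup>2 - \<langle>A u, u\<rangle>\<close> is nonnegative on \<open>W\<close>
  and vanishes at the maximiser \<open>x\<close>; perturbing \<open>x\<close> in the direction of its residual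
  \<open>A x - a x\<close> forces the residual to be zero.\<close>

lemma symmetric_eigenvector:
  fixes A :: "'v::complex_hilbert \<Rightarrow> 'v"
  assumes W: "complex_subspace W" and compact: "compact (W \<inter> sphere 0 1)"
    and nonempty: "W \<inter> sphere 0 1 \<noteq> {}"
    and A: "bounded_linear A" and A_W: "\<And>x. x \<in> W \<Longrightarrow> A x \<in> W"
    and sym: "\<And>x y. cinner (A x) y = cinner x (A y)"
  obtains x a where "x \<in> W" "norm x = 1" "A x = complex_of_real a *\<^sub>C x"
proof -
  interpret A: bounded_linear A by (rule A)
  interpret I: bounded_bilinear "\<lambda>x y::'v. Re (cinner x y)" by (rule bounded_bilinear_Re_cinner)
  have "continuous_on (W \<inter> sphere 0 1) (\<lambda>x. Re (cinner (A x) x))"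
    by (intro I.continuous_on A.continuous_on continuous_intros)
  then obtain x where x: "x \<in> W" "norm x = 1"
    and max: "\<And>y. y \<in> W \<Longrightarrow> norm y = 1 \<Longrightarrow> Re (cinner (A y) y) \<le> Re (cinner (A x) x)"
    using continuous_attains_sup[OF compact nonempty, of "\<lambda>x. Re (cinner (A x) x)"] by force
  define a where "a = Re (cinner (A x) x)"
  have h_nonneg: "Re (cinner (A u) u) \<le> a * (norm u)\<^sup>2" if u: "u \<in> W" for u
  proof (cases "u = 0")
    case False
    define y where "y = (1 / norm u) *\<^sub>R u"
    have "y = complex_of_real (1 / norm u) *\<^sub>C u" unfolding y_def by (rule scaleC_of_real[symmetric])
    then have "y \<in> W" using W u unfolding complex_subspace_def by metis
    moreover have "norm y = 1" using False by (simp add: y_def)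
    ultimately have "Re (cinner (A y) y) \<le> a" unfolding a_def by (rule max)
    moreover have "Re (cinner (A y) y) = Re (cinner (A u) u) / (norm u)\<^sup>2"
      by (simp add: y_def A.scaleR I.scaleR_left I.scaleR_right power2_eq_square)
    ultimately show ?thesis using False by (simp add: divide_le_eq)
  qed (simp add: A.zero)
  define y where "y = A x - a *\<^sub>R x"
  have yW: "y \<in> W"
  proof -
    have "y = A x + complex_of_real (- a) *\<^sub>C x" unfolding scaleC_of_real y_def by simp
    then show ?thesis using W x A_W unfolding complex_subspace_def by metis
  qed
  have key: "2 * t * (norm y)\<^sup>2 \<le> t\<^sup>2 * (a * (norm y)\<^sup>2 - Re (cinner (A y) y))" for t :: real
  proof -
    have "complex_of_real t *\<^sub>C y \<in> W" using W yW unfolding complex_subspace_def by metis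
    then have "x + t *\<^sub>R y \<in> W" using W x unfolding complex_subspace_def scaleC_of_real by metis
    from h_nonneg[OF this]
    have "Re (cinner (A x + t *\<^sub>R A y) (x + t *\<^sub>R y)) \<le> a * (norm (x + t *\<^sub>R y))\<^sup>2"
      by (simp add: A.add A.scaleR)
    moreover have "(norm (x + t *\<^sub>R y))\<^sup>2 = 1 + 2 * t * Re (cinner x y) + t\<^sup>2 * (norm y)\<^sup>2"
      using norm_diff_square[of x "- (t *\<^sub>R y)"] x
      by (simp add: I.minus_right I.scaleR_right power_mult_distrib)
    ultimately have "a + t * Re (cinner (A x) y) + t * Re (cinner (A y) x) + t\<^sup>2 * Re (cinner (A y) y)
        \<le> a * (1 + 2 * t * Re (cinner x y) + t\<^sup>2 * (norm y)\<^sup>2)"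
      by (simp add: I.add_left I.add_right I.scaleR_left I.scaleR_right a_def
          power2_eq_square algebra_simps)
    moreover have "Re (cinner (A y) x) = Re (cinner (A x) y)"
      using sym[of y x] cinner_commute[of y "A x"] by simp
    moreover have "Re (cinner (A x) y) = (norm y)\<^sup>2 + a * Re (cinner x y)"
      using I.diff_left[of "A x" "a *\<^sub>R x" y] cinner_self[of y]
      by (simp add: I.scaleR_left flip: y_def)
    ultimately show ?thesis by (simp add: algebra_simps)
  qed
  have "(norm y)\<^sup>2 = 0"
  proof (rule ccontr)
    assume n: "(norm y)\<^sup>2 \<noteq> 0"
    define b where "b = a * (norm y)\<^sup>2 - Re (cinner (A y) y)"
    have b: "b \<ge> 0" using h_nonneg[OF yW] by (simp add: b_def)
    have n': "(norm y)\<^sup>2 > 0" using n by simp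
    define t where "t = (norm y)\<^sup>2 / (b + 1)"
    have t: "t > 0" using n' b by (simp add: t_def)
    have "2 * t * (norm y)\<^sup>2 \<le> t * (t * b)" using key[of t] by (simp add: b_def power2_eq_square)
    then have "2 * (norm y)\<^sup>2 \<le> t * b" using t by (metis mult.assoc mult.left_commute mult_le_cancel_left_pos)
    also have "t * b \<le> t * (b + 1)" using t by simp
    also have "\<dots> = (norm y)\<^sup>2" using b by (simp add: t_def)
    finally show False using n' by simp
  qed
  then have "A x = complex_of_real a *\<^sub>C x" by (simp add: y_def scaleC_of_real)
  then show thesis using x that by blast
qed

text \<open>\<open>T'\<close> is the Hilbert space adjoint of \<open>T\<close>. Compactness is stated for sequences; it implies
  that \<open>T\<close> is bounded.\<close>

locale compact_normal =
  fixes T T' :: "'v::complex_hilbert \<Rightarrow> 'v"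
  assumes add: "T (x + y) = T x + T y"
    and scaleC: "T (a *\<^sub>C x) = a *\<^sub>C T x"
    and adjoint: "cinner (T x) y = cinner x (T' y)"
    and commute: "T (T' x) = T' (T x)"
    and compact: "bounded (range (f :: nat \<Rightarrow> 'v)) \<Longrightarrow> \<exists>l r. strict_mono r \<and> (\<lambda>n. T (f (r n))) \<longlonglongrightarrow> l"
begin

lemma scaleR: "T (a *\<^sub>R x) = a *\<^sub>R T x"
  by (metis scaleC scaleC_of_real)

lemma bounded_linear: "bounded_linear T"
proof -
  have "\<exists>B. \<forall>x. norm (T x) \<le> norm x * B"
  proof (rule ccontr)
    assume "\<not> ?thesis"
    then have "\<forall>n::nat. \<exists>x. norm (T x) > norm x * real n" by (auto simp: not_le)
    then obtain f where f: "\<And>n::nat. norm (T (f n)) > norm (f n) * real n" by metis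
    define g where "g n = (1 / norm (f n)) *\<^sub>R f n" for n
    have nz: "f n \<noteq> 0" for n
    proof
      assume "f n = 0"
      then show False using f[of n] scaleR[of 0 0] by simp
    qed
    have "norm (g n) = 1" for n using nz[of n] by (simp add: g_def)
    then have "bounded (range g)" unfolding bounded_iff by force
    then obtain l r where r: "strict_mono r" and "(\<lambda>n. T (g (r n))) \<longlonglongrightarrow> l"
      using compact[of g] by blast
    then have "bounded (range (\<lambda>n. T (g (r n))))" using convergent_imp_bounded by blast
    then obtain B where B: "\<And>n. norm (T (g (r n))) \<le> B" unfolding bounded_iff by auto
    obtain n :: nat where n: "real n > B" using reals_Archimedean2 by blast
    have "real (r n) < norm (T (g (r n)))"
      using f[of "r n"] nz[of "r n"] by (simp add: g_def scaleR less_divide_eq mult.commute)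
    moreover have "real n \<le> real (r n)" using seq_suble[OF r] by simp
    ultimately show False using B[of n] n by linarith
  qed
  then show ?thesis by (auto intro: bounded_linear_intro add scaleR)
qed

sublocale T: bounded_linear T by (rule bounded_linear)

lemma adjoint': "cinner (T' x) y = cinner x (T y)"
  using adjoint[of y x] cinner_commute[of "T' x" y] cinner_commute[of x "T y"] by simp

lemma norm_adjoint: "norm (T' x) = norm (T x)"
proof -
  have "cinner (T' x) (T' x) = cinner (T x) (T x)"
    by (metis adjoint adjoint' commute)
  then have "(norm (T' x))\<^sup>2 = (norm (T x))\<^sup>2"
    unfolding cinner_self of_real_eq_iff .
  then show ?thesis by simp
qed

lemma adjoint_add: "T' (x + y) = T' x + T' y"
  by (rule cinner_left_eqI) (simp add: cinner_algebra flip: adjoint)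

lemma adjoint_scaleC: "T' (a *\<^sub>C x) = a *\<^sub>C T' x"
  by (rule cinner_left_eqI) (simp add: cinner_algebra flip: adjoint)

lemma adjoint_scaleR: "T' (a *\<^sub>R x) = a *\<^sub>R T' x"
  by (metis adjoint_scaleC scaleC_of_real)

sublocale T': bounded_linear T'
proof -
  obtain B where "\<And>x. norm (T x) \<le> norm x * B" using T.bounded by blast
  then show "bounded_linear T'"
    by (intro bounded_linear_intro[where K = B] adjoint_add adjoint_scaleR) (simp add: norm_adjoint)
qed

lemma eigenvector_adjoint: assumes "T x = a *\<^sub>C x" shows "T' x = cnj a *\<^sub>C x"
proof -
  have "(norm (T' x - cnj a *\<^sub>C x))\<^sup>2 = 0"
    using assms
    by (simp add: norm_diff_square norm_adjoint adjoint' cinner_algebra cinner_self power_mult_distrib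
        complex_mult_cnj cmod_power2 flip: of_real_power) (simp add: algebra_simps power2_eq_square)
  then show ?thesis by simp
qed

text \<open>On an invariant closed subspace a compact normal operator attains its norm, and does so at an
  eigenvector. If \<open>r > 0\<close> is the norm of \<open>T\<close> on \<open>H\<close>, a maximising sequence \<open>x\<^sub>n\<close> satisfies
  \<open>T' T x\<^sub>n - r\<^sup>2 x\<^sub>n \<longlonglongrightarrow> 0\<close>, so compactness yields an eigenvector of \<open>T' T\<close> for
  \<open>r\<^sup>2\<close>. The unit sphere of this eigenspace is compact, hence the commuting symmetric
  operators \<open>T + T'\<close> and \<open>\<i> (T' - T)\<close> have a common eigenvector in it, which is an
  eigenvector of \<open>T\<close> for an eigenvalue of modulus \<open>r\<close>.\<close>

lemma norm_le_eigenvalue_bound: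
  assumes H: "complex_subspace H" and closed: "closed H"
    and T_H: "\<And>x. x \<in> H \<Longrightarrow> T x \<in> H" and T'_H: "\<And>x. x \<in> H \<Longrightarrow> T' x \<in> H"
    and \<rho>: "0 \<le> \<rho>"
    and eigenvalue: "\<And>x a. x \<in> H \<Longrightarrow> x \<noteq> 0 \<Longrightarrow> T x = a *\<^sub>C x \<Longrightarrow> cmod a \<le> \<rho>"
    and x: "x \<in> H"
  shows "norm (T x) \<le> \<rho> * norm x"
proof (rule ccontr)
  assume "\<not> ?thesis"
  then have x_gt: "norm (T x) > \<rho> * norm x" by simp
  have H_scaleC: "a *\<^sub>C y \<in> H" if "y \<in> H" for a y using H that by (simp add: complex_subspace_def)
  have H_scaleR: "a *\<^sub>R y \<in> H" if "y \<in> H" for a y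
    using H_scaleC[OF that, of "complex_of_real a"] by (simp add: scaleC_of_real)
  define r where "r = (SUP y\<in>H \<inter> sphere 0 1. norm (T y))"
  obtain B where B: "\<And>x. norm (T x) \<le> norm x * B" using T.bounded by blast
  have bdd: "bdd_above ((\<lambda>y. norm (T y)) ` (H \<inter> sphere 0 1))"
  proof (rule bdd_aboveI2)
    show "norm (T y) \<le> B" if "y \<in> H \<inter> sphere 0 1" for y using B[of y] that by simp
  qed
  have x0: "x \<noteq> 0" using x_gt by (auto simp: T.zero)
  have unit: "(1 / norm y) *\<^sub>R y \<in> H \<inter> sphere 0 1" if "y \<in> H" "y \<noteq> 0" for y
    using that H_scaleR by simp
  have le_r: "norm (T y) \<le> r * norm y" if "y \<in> H" for y
  proof (cases "y = 0")
    case False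
    have "norm (T ((1 / norm y) *\<^sub>R y)) \<le> r"
      unfolding r_def by (rule cSUP_upper[OF unit[OF that False] bdd])
    then show ?thesis using False by (simp add: T.scaleR divide_le_eq)
  qed (simp add: T.zero)
  have "\<rho> * norm x < r * norm x" using x_gt le_r[OF x] by linarith
  then have r: "r > \<rho>" using x0 mult_less_cancel_right_pos[of "norm x" \<rho> r] by simp
  then have r_pos: "r > 0" using \<rho> by simp
  have defect: "(norm (T' (T y) - r\<^sup>2 *\<^sub>R y))\<^sup>2 \<le> 2 * r\<^sup>2 * (r\<^sup>2 * (norm y)\<^sup>2 - (norm (T y))\<^sup>2)"
    if y: "y \<in> H" for y
  proof -
    have "norm (T' (T y)) \<le> r * norm (T y)"
      unfolding norm_adjoint by (rule le_r[OF T_H[OF y]])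
    also have "\<dots> \<le> r * (r * norm y)" using le_r[OF y] r_pos by simp
    finally have "(norm (T' (T y)))\<^sup>2 \<le> (r * (r * norm y))\<^sup>2" by (intro power_mono) auto
    moreover have "Re (cinner (T' (T y)) (r\<^sup>2 *\<^sub>R y)) = r\<^sup>2 * (norm (T y))\<^sup>2"
    proof -
      have "cinner (T' (T y)) (complex_of_real (r\<^sup>2) *\<^sub>C y) = of_real (r\<^sup>2 * (norm (T y))\<^sup>2)"
        by (simp add: cinner_scaleC_right adjoint' cinner_self)
      then show ?thesis unfolding scaleC_of_real by simp
    qed
    ultimately show ?thesis
      by (simp add: norm_diff_square power_mult_distrib algebra_simps)
  qed
  have "\<exists>y\<in>H \<inter> sphere 0 1. r - 1 / real (Suc n) < norm (T y)" for n
  proof -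
    have "H \<inter> sphere 0 1 \<noteq> {}" using unit[OF x x0] by blast
    moreover have "r - 1 / real (Suc n) < r" by simp
    ultimately show ?thesis unfolding r_def using less_cSUP_iff[OF _ bdd] by metis
  qed
  then obtain f where f: "\<And>n. f n \<in> H" "\<And>n. norm (f n) = 1"
    "\<And>n. r - 1 / real (Suc n) < norm (T (f n))" by (auto simp: Bex_def) metis
  have "(\<lambda>n. norm (T (f n))) \<longlonglongrightarrow> r"
  proof (rule tendsto_sandwich[OF _ _ _ tendsto_const[of r]])
    show "(\<lambda>n. r - 1 / real (Suc n)) \<longlonglongrightarrow> r"
      using tendsto_diff[OF tendsto_const LIMSEQ_inverse_real_of_nat, of r] by (simp add: inverse_eq_divide)
    show "\<forall>\<^sub>F n in sequentially. r - 1 / real (Suc n) \<le> norm (T (f n))"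
      using f(3) by (intro always_eventually) (metis less_imp_le)
    show "\<forall>\<^sub>F n in sequentially. norm (T (f n)) \<le> r"
      using le_r[OF f(1)] f(2) by (intro always_eventually) simp
  qed
  then have bound0: "(\<lambda>n. 2 * r\<^sup>2 * (r\<^sup>2 * (norm (f n))\<^sup>2 - (norm (T (f n)))\<^sup>2)) \<longlonglongrightarrow> 2 * r\<^sup>2 * (r\<^sup>2 * 1\<^sup>2 - r\<^sup>2)"
    unfolding f(2) by (intro tendsto_intros)
  have "(\<lambda>n. (norm (T' (T (f n)) - r\<^sup>2 *\<^sub>R f n))\<^sup>2) \<longlonglongrightarrow> 0"
    by (rule tendsto_sandwich[OF _ _ tendsto_const])
      (use bound0 in \<open>auto intro!: always_eventually defect f(1)\<close>)
  then have "(\<lambda>n. sqrt ((norm (T' (T (f n)) - r\<^sup>2 *\<^sub>R f n))\<^sup>2)) \<longlonglongrightarrow> sqrt 0"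
    by (rule tendsto_real_sqrt)
  then have d0: "(\<lambda>n. T' (T (f n)) - r\<^sup>2 *\<^sub>R f n) \<longlonglongrightarrow> 0" by (simp add: tendsto_norm_zero_iff)
  have "bounded (range f)" unfolding bounded_iff using f(2) by force
  then obtain l k where k: "strict_mono k" and l: "(\<lambda>n. T (f (k n))) \<longlonglongrightarrow> l" using compact[of f] by blast
  have "(\<lambda>n. T' (T (f (k n))) - (T' (T (f (k n))) - r\<^sup>2 *\<^sub>R f (k n))) \<longlonglongrightarrow> T' l - 0"
    using LIMSEQ_subseq_LIMSEQ[OF d0 k] by (intro tendsto_diff T'.tendsto l) (simp add: o_def)
  then have "(\<lambda>n. r\<^sup>2 *\<^sub>R f (k n)) \<longlonglongrightarrow> T' l" by simp
  note tendsto_scaleR[OF tendsto_const[of "1 / r\<^sup>2"] this]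
  moreover define u where "u = (1 / r\<^sup>2) *\<^sub>R T' l"
  ultimately have lim: "(\<lambda>n. f (k n)) \<longlonglongrightarrow> u" using r_pos by simp
  have uH: "u \<in> H" using closed_sequentially[OF closed, of "\<lambda>n. f (k n)" u] f(1) lim by simp
  have u1: "norm u = 1" using LIMSEQ_unique[OF tendsto_norm[OF lim]] f(2) by fastforce
  have "(\<lambda>n. T' (T (f (k n))) - r\<^sup>2 *\<^sub>R f (k n)) \<longlonglongrightarrow> T' (T u) - r\<^sup>2 *\<^sub>R u"
    by (intro tendsto_intros T'.tendsto T.tendsto lim)
  then have "T' (T u) - r\<^sup>2 *\<^sub>R u = 0"
    using LIMSEQ_unique LIMSEQ_subseq_LIMSEQ[OF d0 k] unfolding o_def by blast
  then have u: "T' (T u) = r\<^sup>2 *\<^sub>R u" by simp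

  define E where "E = {y \<in> H. T' (T y) = r\<^sup>2 *\<^sub>R y}"
  have TE: "T y \<in> E" if "y \<in> E" for y using that T_H unfolding E_def by (auto simp flip: commute) (metis commute T.scaleR)
  have T'E: "T' y \<in> E" if "y \<in> E" for y
    using that T'_H unfolding E_def by (auto simp: commute T'.scaleR)
  have scaleCR: "a *\<^sub>C (b *\<^sub>R y) = b *\<^sub>R (a *\<^sub>C y)" for a b and y :: 'v
    by (simp add: scaleC_scaleC mult.commute flip: scaleC_of_real)
  have E: "complex_subspace E"
    using H unfolding complex_subspace_def E_def
    by (auto simp: T.zero T'.zero T.add T'.add scaleC adjoint_scaleC scaleR_add_right scaleCR)
  have closed_E: "closed E"
  proof -
    have "E = H \<inter> {y. T' (T y) = r\<^sup>2 *\<^sub>R y}" by (auto simp: E_def)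
    then show ?thesis
      by (auto intro!: closed_Int closed closed_Collect_eq T'.continuous_on T.continuous_on continuous_intros)
  qed
  have compact_E: "compact (E \<inter> sphere 0 1)"
    unfolding compact_def
  proof (intro allI impI)
    fix g :: "nat \<Rightarrow> 'v" assume g: "\<forall>n. g n \<in> E \<inter> sphere 0 1"
    then have "bounded (range g)" unfolding bounded_iff by force
    then obtain l k where k: "strict_mono k" and l: "(\<lambda>n. T (g (k n))) \<longlonglongrightarrow> l" using compact[of g] by blast
    have "(\<lambda>n. (1 / r\<^sup>2) *\<^sub>R T' (T (g (k n)))) \<longlonglongrightarrow> (1 / r\<^sup>2) *\<^sub>R T' l"
      by (intro tendsto_intros T'.tendsto l)
    moreover have "(1 / r\<^sup>2) *\<^sub>R T' (T (g (k n))) = g (k n)" for n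
      using g r_pos by (simp add: E_def)
    ultimately have "(g \<circ> k) \<longlonglongrightarrow> (1 / r\<^sup>2) *\<^sub>R T' l" by (simp add: o_def)
    moreover have "closed (E \<inter> sphere 0 1)"
      unfolding sphere_def dist_norm
      by (intro closed_Int closed_E closed_Collect_eq continuous_intros)
    then have "(1 / r\<^sup>2) *\<^sub>R T' l \<in> E \<inter> sphere 0 1"
      by (rule closed_sequentially[OF _ _ calculation(1)]) (use g in simp)
    ultimately show "\<exists>l\<in>E \<inter> sphere 0 1. \<exists>k. strict_mono k \<and> (g \<circ> k) \<longlonglongrightarrow> l" using k by blast
  qed
  have "bounded_linear (\<lambda>y. T y + T' y)"
    by (intro bounded_linear_add T.bounded_linear_axioms T'.bounded_linear_axioms)
  moreover have "T y + T' y \<in> E" if "y \<in> E" for y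
    using E TE[OF that] T'E[OF that] by (simp add: complex_subspace_def)
  moreover have "cinner (T y + T' y) v = cinner y (T v + T' v)" for y v
    by (simp add: cinner_algebra adjoint adjoint')
  moreover have "E \<inter> sphere 0 1 \<noteq> {}" using uH u1 u by (auto simp: E_def)
  ultimately obtain y a where y: "y \<in> E" "norm y = 1" "T y + T' y = complex_of_real a *\<^sub>C y"
    using symmetric_eigenvector[OF E compact_E, of "\<lambda>y. T y + T' y"] by blast
  define E2 where "E2 = {y \<in> E. T y + T' y = complex_of_real a *\<^sub>C y}"
  have E2: "complex_subspace E2"
    using E unfolding complex_subspace_def E2_def
    by (auto simp: T.zero T'.zero T.add T'.add scaleC adjoint_scaleC scaleC_add_right algebra_simps)
       (simp_all add: scaleC_scaleC mult.commute flip: scaleC_add_right)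
  have "closed {y. T y + T' y = a *\<^sub>R y}"
    by (intro closed_Collect_eq continuous_intros T'.continuous_on T.continuous_on)
  moreover have "E2 \<inter> sphere 0 1 = (E \<inter> sphere 0 1) \<inter> {y. T y + T' y = a *\<^sub>R y}"
    by (auto simp: E2_def scaleC_of_real)
  ultimately have compact_E2: "compact (E2 \<inter> sphere 0 1)"
    using compact_E by (metis compact_Int_closed)
  have TE2: "T y \<in> E2" if "y \<in> E2" for y
  proof -
    have "T (T y) + T' (T y) = T (T y + T' y)" by (simp add: T.add commute)
    then show ?thesis using that TE by (simp add: E2_def scaleC)
  qed
  have T'E2: "T' y \<in> E2" if "y \<in> E2" for y
  proof -
    have "T (T' y) + T' (T' y) = T' (T y + T' y)" by (simp add: T'.add commute)
    then show ?thesis using that T'E by (simp add: E2_def adjoint_scaleC)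
  qed
  have "bounded_linear (\<lambda>y. \<i> *\<^sub>C (T' y - T y))"
    by (intro bounded_linear_compose[OF bounded_bilinear.bounded_linear_right[OF bounded_bilinear_scaleC]]
        bounded_linear_sub T.bounded_linear_axioms T'.bounded_linear_axioms)
  moreover have "\<i> *\<^sub>C (T' y - T y) \<in> E2" if "y \<in> E2" for y
  proof -
    have "T' y + (-1) *\<^sub>C T y \<in> E2"
      using E2 TE2[OF that] T'E2[OF that] unfolding complex_subspace_def by blast
    then show ?thesis using E2 unfolding complex_subspace_def by auto
  qed
  moreover have "cinner (\<i> *\<^sub>C (T' y - T y)) v = cinner y (\<i> *\<^sub>C (T' v - T v))" for y v
    by (simp add: cinner_algebra adjoint adjoint' algebra_simps)
  moreover have "E2 \<inter> sphere 0 1 \<noteq> {}" using y by (auto simp: E2_def)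
  ultimately obtain v b where v: "v \<in> E2" "norm v = 1" and vb: "\<i> *\<^sub>C (T' v - T v) = complex_of_real b *\<^sub>C v"
    using symmetric_eigenvector[OF E2 compact_E2, of "\<lambda>y. \<i> *\<^sub>C (T' y - T y)"] by blast
  define \<mu> where "\<mu> = (of_real a + \<i> * of_real b) / 2"
  have "2 *\<^sub>C T v = (T v + T' v) + \<i> *\<^sub>C (\<i> *\<^sub>C (T' v - T v))"
    using scaleC_add_left[of 1 1 "T v"] by (simp add: scaleC_scaleC)
  also have "\<dots> = (of_real a + \<i> * of_real b) *\<^sub>C v"
    using v(1) by (simp add: vb E2_def scaleC_scaleC scaleC_add_left)
  finally have "(1/2) *\<^sub>C (2 *\<^sub>C T v) = (1/2) *\<^sub>C ((of_real a + \<i> * of_real b) *\<^sub>C v)" by simp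
  then have Tv: "T v = \<mu> *\<^sub>C v" by (simp add: scaleC_scaleC \<mu>_def)
  have vE: "v \<in> H" "T' (T v) = r\<^sup>2 *\<^sub>R v" using v by (auto simp: E2_def E_def)
  moreover have "v \<noteq> 0" using v by auto
  ultimately have "cmod \<mu> \<le> \<rho>" using eigenvalue[OF _ _ Tv] by blast
  moreover have "(cmod \<mu>)\<^sup>2 = r\<^sup>2"
  proof -
    have "norm (T' (T v)) = r\<^sup>2" using vE v by simp
    moreover have "norm (T' (T v)) = (cmod \<mu>)\<^sup>2"
      using v by (simp add: norm_adjoint Tv scaleC power2_eq_square)
    ultimately show ?thesis by simp
  qed
  then have "cmod \<mu> = r" using r_pos by (simp add: power2_eq_iff_nonneg)
  ultimately show False using r by simp
qed


text \<open>Otherwise there are unit vectors that solve \<open>x = z T x\<close> up to an arbitrarily small error, and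
  compactness produces an exact unit solution in the limit.\<close>

lemma id_minus_bounded_below:
  assumes inj: "\<And>x. x = z *\<^sub>C T x \<Longrightarrow> x = 0"
  obtains c where "c > 0" "\<And>x. c * norm x \<le> norm (x - z *\<^sub>C T x)"
proof -
  have "\<exists>c>0. \<forall>x. c * norm x \<le> norm (x - z *\<^sub>C T x)"
  proof (rule ccontr)
    assume neg: "\<not> ?thesis"
    have "\<exists>x. norm (x - z *\<^sub>C T x) < 1 / real (Suc n) * norm x" for n
      using neg by (metis not_le of_nat_0_less_iff zero_less_Suc zero_less_divide_1_iff)
    then obtain f where f: "\<And>n. norm (f n - z *\<^sub>C T (f n)) < 1 / real (Suc n) * norm (f n)" by metis
    have nz: "f n \<noteq> 0" for n using f[of n] by (auto simp: T.zero)
    define g where "g n = (1 / norm (f n)) *\<^sub>R f n" for n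
    have g1: "norm (g n) = 1" for n using nz[of n] by (simp add: g_def)
    have small: "norm (g n - z *\<^sub>C T (g n)) \<le> 1 / real (Suc n)" for n
    proof -
      have "g n - z *\<^sub>C T (g n) = (1 / norm (f n)) *\<^sub>R (f n - z *\<^sub>C T (f n))"
        unfolding g_def T.scaleR bounded_bilinear.scaleR_right[OF bounded_bilinear_scaleC]
        by (rule scaleR_diff_right[symmetric])
      then show ?thesis using f[of n] nz[of n] by (simp add: divide_le_eq)
    qed
    have "bounded (range g)" unfolding bounded_iff using g1 by force
    then obtain l k where k: "strict_mono k" and l: "(\<lambda>n. T (g (k n))) \<longlonglongrightarrow> l"
      using compact[of g] by blast
    have "(\<lambda>n. g n - z *\<^sub>C T (g n)) \<longlonglongrightarrow> 0"
    proof (rule Lim_null_comparison)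
      show "\<forall>\<^sub>F n in sequentially. norm (g n - z *\<^sub>C T (g n)) \<le> inverse (real (Suc n))"
        using small by (simp add: inverse_eq_divide)
    qed (rule LIMSEQ_inverse_real_of_nat)
    then have d0: "(\<lambda>n. g (k n) - z *\<^sub>C T (g (k n))) \<longlonglongrightarrow> 0"
      using LIMSEQ_subseq_LIMSEQ[OF _ k] by (fastforce simp: o_def)
    have "(\<lambda>n. (g (k n) - z *\<^sub>C T (g (k n))) + z *\<^sub>C T (g (k n))) \<longlonglongrightarrow> 0 + z *\<^sub>C l"
      by (intro tendsto_add tendsto_scaleC tendsto_const l d0)
    then have lim: "(\<lambda>n. g (k n)) \<longlonglongrightarrow> z *\<^sub>C l" by simp
    have "(\<lambda>n. g (k n) - z *\<^sub>C T (g (k n))) \<longlonglongrightarrow> z *\<^sub>C l - z *\<^sub>C T (z *\<^sub>C l)"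
      by (intro tendsto_diff tendsto_scaleC tendsto_const T.tendsto lim)
    then have "z *\<^sub>C l = z *\<^sub>C T (z *\<^sub>C l)" using LIMSEQ_unique[OF d0] by fastforce
    then have "z *\<^sub>C l = 0" by (rule inj)
    moreover have "norm (z *\<^sub>C l) = 1" using LIMSEQ_unique[OF tendsto_norm[OF lim]] g1 by fastforce
    ultimately show False by simp
  qed
  then show thesis using that by blast
qed

text \<open>For \<open>B = 1 - z T\<close> bounded below, \<open>B' B\<close> is coercive, and damped Richardson iteration
  for \<open>B' B x = y\<close> is a contraction. By normality \<open>B' B = B B'\<close>, so both \<open>B\<close> and \<open>B'\<close>
  are onto.\<close>

lemma id_minus_normal_surj:
  assumes inj: "\<And>x. x = z *\<^sub>C T x \<Longrightarrow> x = 0"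
  defines "B \<equiv> (\<lambda>x. x - z *\<^sub>C T x)" and "B' \<equiv> (\<lambda>x. x - cnj z *\<^sub>C T' x)"
  shows "\<exists>x. B' (B x) = y"
proof -
  obtain c where c: "c > 0" and below: "\<And>x. c * norm x \<le> norm (B x)"
    using id_minus_bounded_below[OF inj] unfolding B_def by blast
  have B: "bounded_linear B" unfolding B_def
    by (intro bounded_linear_sub bounded_linear_ident T.bounded_linear_axioms
        bounded_linear_compose[OF bounded_bilinear.bounded_linear_right[OF bounded_bilinear_scaleC]])
  have B': "bounded_linear B'" unfolding B'_def
    by (intro bounded_linear_sub bounded_linear_ident T'.bounded_linear_axioms
        bounded_linear_compose[OF bounded_bilinear.bounded_linear_right[OF bounded_bilinear_scaleC]])
  define P where "P x = B' (B x)" for x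
  have "bounded_linear P" unfolding P_def by (rule bounded_linear_compose[OF B' B])
  then interpret P: bounded_linear P .
  obtain m0 where m0: "\<And>x. norm (P x) \<le> norm x * m0" using P.bounded by blast
  \<comment> \<open>Since \<open>c\<^sup>2 \<le> m\<close>, the contraction factor \<open>q\<close> below is real, even if the space is trivial.\<close>
  define m where "m = max m0 (c\<^sup>2)"
  have m: "m > 0" "c\<^sup>2 \<le> m" using c by (auto simp: m_def less_max_iff_disj)
  have P_le: "norm (P x) \<le> m * norm x" for x
    using m0[of x] mult_left_mono[of m0 m "norm x"] by (simp add: m_def mult.commute)
  have coercive: "c\<^sup>2 * (norm x)\<^sup>2 \<le> Re (cinner x (P x))" for x
  proof -
    have "cinner x (P x) = cinner (B x) (B x)"
      by (simp add: P_def B_def B'_def cinner_algebra adjoint T'.diff adjoint_scaleC algebra_simps)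
    moreover have "(c * norm x)\<^sup>2 \<le> (norm (B x))\<^sup>2" using below[of x] c by (intro power_mono) auto
    ultimately show ?thesis by (simp add: cinner_self power_mult_distrib)
  qed
  \<comment> \<open>The step size that minimises \<open>1 - 2 t c\<^sup>2 + t\<^sup>2 m\<^sup>2\<close>.\<close>
  define t where "t = c\<^sup>2 / m\<^sup>2"
  have t: "t > 0" using c m by (simp add: t_def)
  define q where "q = sqrt (1 - (c\<^sup>2 / m)\<^sup>2)"
  have cm: "0 < c\<^sup>2 / m" "c\<^sup>2 / m \<le> 1" using c m by auto
  have q: "0 \<le> q" "q < 1" using cm by (auto simp: q_def power_le_one)
  define F where "F x = x - t *\<^sub>R (P x - y)" for x
  have contr: "norm (u - t *\<^sub>R P u) \<le> q * norm u" for u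
  proof (rule power2_le_imp_le)
    have "Re (cinner u (t *\<^sub>R P u)) = t * Re (cinner u (P u))"
      by (simp add: cinner_algebra flip: scaleC_of_real)
    then have "(norm (u - t *\<^sub>R P u))\<^sup>2 = (norm u)\<^sup>2 - 2 * (t * Re (cinner u (P u))) + (t * norm (P u))\<^sup>2"
      using t by (simp add: norm_diff_square)
    also have "\<dots> \<le> (norm u)\<^sup>2 - 2 * (t * (c\<^sup>2 * (norm u)\<^sup>2)) + (t * (m * norm u))\<^sup>2"
      using t coercive[of u] P_le[of u] m by (intro add_mono diff_mono mult_left_mono power_mono) auto
    also have "\<dots> = (1 - 2 * (t * c\<^sup>2) + (t * m)\<^sup>2) * (norm u)\<^sup>2" by (simp add: algebra_simps power_mult_distrib)
    also have "t * c\<^sup>2 = (c\<^sup>2 / m)\<^sup>2" by (simp add: t_def power2_eq_square)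
    also have "t * m = c\<^sup>2 / m" using m by (simp add: t_def power2_eq_square)
    also have "(1 - 2 * (c\<^sup>2 / m)\<^sup>2 + (c\<^sup>2 / m)\<^sup>2) = q\<^sup>2" using cm by (simp add: q_def power_le_one)
    finally show "(norm (u - t *\<^sub>R P u))\<^sup>2 \<le> (q * norm u)\<^sup>2" by (simp add: power_mult_distrib)
  qed (use q in auto)
  have "dist (F u) (F v) \<le> q * dist u v" for u v
    using contr[of "u - v"] by (simp add: F_def dist_norm P.diff algebra_simps)
  then obtain x where "F x = x" using banach_fix_type[OF q] by blast
  then show ?thesis using t by (auto simp: F_def P_def)
qed

end

section \<open>The resolvent of an operator with compact normal inverse\<close>

lemma compact_operatorD:
  assumes "compact_operator T" "bounded (range (f :: nat \<Rightarrow> 'v::complex_hilbert))"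
  shows "\<exists>l r. strict_mono r \<and> (\<lambda>n. T (f (r n))) \<longlonglongrightarrow> l"
proof -
  have "compact (closure (T ` range f))" using assms unfolding compact_operator_def by blast
  moreover have "\<forall>n. (T \<circ> f) n \<in> closure (T ` range f)"
    using closure_subset[of "T ` range f"] by auto
  ultimately obtain l r where "strict_mono (r :: nat \<Rightarrow> nat)" "(T \<circ> f \<circ> r) \<longlonglongrightarrow> l"
    unfolding compact_def by blast
  then show ?thesis unfolding o_def by blast
qed

locale normal_resolvent =
  fixes D :: "'v::complex_hilbert set" and L :: "'v \<Rightarrow> 'v"
  assumes linear: "complex_linear_on D L"
    and bijective: "bij_betw L D UNIV"
    and compact_inverse: "compact_operator (inv_into D L)"
    and normal_inverse: "normal_operator (inv_into D L)"
begin

definition resolvent :: "complex \<Rightarrow> 'v \<Rightarrow> 'v" where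
  "resolvent z x = solution_map D L x z"

definition orth_to_eigenspaces :: "complex set \<Rightarrow> 'v set" where
  "orth_to_eigenspaces F = {x. \<forall>l\<in>F. \<forall>e\<in>eigenspace D L l. cinner x e = 0}"

lemma D_add: "x \<in> D \<Longrightarrow> y \<in> D \<Longrightarrow> x + y \<in> D"
  and D_scaleC: "x \<in> D \<Longrightarrow> a *\<^sub>C x \<in> D"
  and L_add: "x \<in> D \<Longrightarrow> y \<in> D \<Longrightarrow> L (x + y) = L x + L y"
  and L_scaleC: "x \<in> D \<Longrightarrow> L (a *\<^sub>C x) = a *\<^sub>C L x"
  using linear by (auto simp: complex_linear_on_def complex_subspace_def)

lemma D_diff: "x \<in> D \<Longrightarrow> y \<in> D \<Longrightarrow> x - y \<in> D"
  using D_add[of x "(-1) *\<^sub>C y"] D_scaleC[of y "-1"] by simp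

lemma L_diff: "x \<in> D \<Longrightarrow> y \<in> D \<Longrightarrow> L (x - y) = L x - L y"
  using L_add[of x "(-1) *\<^sub>C y"] D_scaleC[of y "-1"] L_scaleC[of y "-1"] by simp

lemma inverse_in_D: "inv_into D L x \<in> D"
  using bijective by (simp add: bij_betw_def inv_into_into)

lemma L_inverse [simp]: "L (inv_into D L x) = x"
  using bijective by (simp add: bij_betw_def f_inv_into_f)

lemma inverse_L: "x \<in> D \<Longrightarrow> inv_into D L (L x) = x"
  using bijective by (simp add: bij_betw_def)

lemma obtain_adjoint_of_inverse: obtains K' where "compact_normal (inv_into D L) K'"
proof -
  obtain K' where K': "\<And>x y. cinner (inv_into D L x) y = cinner x (K' y)"
      "inv_into D L \<circ> K' = K' \<circ> inv_into D L"
    using normal_inverse unfolding normal_operator_def by blast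
  have "compact_normal (inv_into D L) K'"
  proof
    fix x y a
    show "inv_into D L (x + y) = inv_into D L x + inv_into D L y"
         "inv_into D L (a *\<^sub>C x) = a *\<^sub>C inv_into D L x"
      using compact_inverse by (auto simp: compact_operator_def complex_linear_on_def)
    show "inv_into D L (K' x) = K' (inv_into D L x)" using K'(2) by (metis comp_apply)
  qed (use K'(1) compact_operatorD[OF compact_inverse] in auto)
  then show thesis using that by blast
qed

lemma inverse_inj:
  assumes z: "z \<notin> spectrum D L" and x: "x = z *\<^sub>C inv_into D L x" shows "x = 0"
proof -
  define u where "u = inv_into D L x"
  have u: "u \<in> D" "L u = x" by (simp_all add: u_def inverse_in_D)
  have x: "x = z *\<^sub>C u" unfolding u_def by (rule x)
  then have "u = 0" using z u by (auto simp: spectrum_def)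
  then show ?thesis using x by simp
qed

lemma resolvent_ex1:
  assumes z: "z \<notin> spectrum D L"
  shows "\<exists>!s. s \<in> D \<and> L s - z *\<^sub>C s = x"
proof -
  obtain K' where "compact_normal (inv_into D L) K'" by (rule obtain_adjoint_of_inverse)
  then interpret K: compact_normal "inv_into D L" K' .
  obtain a where a: "(a - z *\<^sub>C inv_into D L a) - cnj z *\<^sub>C K' (a - z *\<^sub>C inv_into D L a) = x"
    using K.id_minus_normal_surj[OF inverse_inj[OF z]] by blast
  define b where "b = a - cnj z *\<^sub>C K' a"
  have b: "b - z *\<^sub>C inv_into D L b = x"
    unfolding a[symmetric] b_def
    by (simp add: K.T.diff K.T'.diff K.scaleC K.adjoint_scaleC K.commute scaleC_algebra
        scaleC_scaleC mult.commute)
  have unique: "s = t" if "s \<in> D" "L s - z *\<^sub>C s = x" "t \<in> D" "L t - z *\<^sub>C t = x" for s t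
  proof (rule ccontr)
    assume "s \<noteq> t"
    moreover have "L (s - t) = z *\<^sub>C (s - t)"
    proof -
      have "L (s - t) - z *\<^sub>C (s - t) = (L s - z *\<^sub>C s) - (L t - z *\<^sub>C t)"
        using that(1,3) by (simp add: L_diff scaleC_algebra)
      then show ?thesis using that by simp
    qed
    ultimately show False using z D_diff[of s t] that unfolding spectrum_def by auto
  qed
  show ?thesis
    by (rule ex1I[of _ "inv_into D L b"]) (use unique inverse_in_D b in auto)
qed

context
  fixes z :: complex
  assumes z: "z \<notin> spectrum D L"
begin

lemma resolvent_in_D: "resolvent z x \<in> D"
  and L_resolvent: "L (resolvent z x) - z *\<^sub>C resolvent z x = x"
  using theI'[OF resolvent_ex1[OF z]] by (auto simp: resolvent_def solution_map_def)

lemma resolvent_eqI: "s \<in> D \<Longrightarrow> L s - z *\<^sub>C s = x \<Longrightarrow> resolvent z x = s"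
  using resolvent_ex1[OF z] resolvent_in_D L_resolvent by blast

lemma resolvent_add: "resolvent z (x + y) = resolvent z x + resolvent z y"
proof (rule resolvent_eqI)
  have "L (resolvent z x + resolvent z y) - z *\<^sub>C (resolvent z x + resolvent z y)
      = (L (resolvent z x) - z *\<^sub>C resolvent z x) + (L (resolvent z y) - z *\<^sub>C resolvent z y)"
    by (simp add: L_add resolvent_in_D scaleC_algebra)
  then show "L (resolvent z x + resolvent z y) - z *\<^sub>C (resolvent z x + resolvent z y) = x + y"
    by (simp add: L_resolvent)
qed (simp add: D_add resolvent_in_D)

lemma resolvent_scaleC: "resolvent z (a *\<^sub>C x) = a *\<^sub>C resolvent z x"
proof (rule resolvent_eqI)
  have "L (a *\<^sub>C resolvent z x) - z *\<^sub>C a *\<^sub>C resolvent z x = a *\<^sub>C (L (resolvent z x) - z *\<^sub>C resolvent z x)"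
    by (simp add: L_scaleC resolvent_in_D scaleC_algebra scaleC_scaleC mult.commute)
  then show "L (a *\<^sub>C resolvent z x) - z *\<^sub>C a *\<^sub>C resolvent z x = a *\<^sub>C x"
    by (simp add: L_resolvent)
qed (simp add: D_scaleC resolvent_in_D)

lemma resolvent_eigenvector:
  assumes l: "l \<in> spectrum D L" and e: "e \<in> eigenspace D L l"
  shows "resolvent z e = (1 / (l - z)) *\<^sub>C e"
proof (rule resolvent_eqI)
  have "l \<noteq> z" using l z by auto
  have e: "e \<in> D" "L e = l *\<^sub>C e" using e by (auto simp: eigenspace_def)
  have "L ((1 / (l - z)) *\<^sub>C e) - z *\<^sub>C (1 / (l - z)) *\<^sub>C e = ((1 / (l - z)) * (l - z)) *\<^sub>C e"
    using e by (simp add: L_scaleC scaleC_scaleC flip: scaleC_diff_left)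
      (simp flip: diff_divide_distrib)
  then show "L ((1 / (l - z)) *\<^sub>C e) - z *\<^sub>C (1 / (l - z)) *\<^sub>C e = e" using \<open>l \<noteq> z\<close> by simp
  show "(1 / (l - z)) *\<^sub>C e \<in> D" using e D_scaleC by simp
qed

lemma resolvent_eigenvalue:
  assumes x: "x \<noteq> 0" "resolvent z x = a *\<^sub>C x"
  shows "a \<noteq> 0" "z + 1 / a \<in> spectrum D L" "x \<in> eigenspace D L (z + 1 / a)"
proof -
  have Lx: "a *\<^sub>C x \<in> D" "L (a *\<^sub>C x) - z *\<^sub>C a *\<^sub>C x = x"
    using resolvent_in_D[of x] L_resolvent[of x] x by auto
  show a: "a \<noteq> 0"
    using Lx x L_scaleC[of "a *\<^sub>C x" 0] by auto
  have xD: "x \<in> D" using D_scaleC[OF Lx(1), of "1 / a"] a by (simp add: scaleC_scaleC)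
  have "a *\<^sub>C L x = x + z *\<^sub>C a *\<^sub>C x" using Lx xD by (simp add: L_scaleC algebra_simps)
  then have "(1 / a) *\<^sub>C (a *\<^sub>C L x) = (1 / a) *\<^sub>C (x + z *\<^sub>C a *\<^sub>C x)" by simp
  then have "L x = (z + 1 / a) *\<^sub>C x" using a by (simp add: scaleC_scaleC scaleC_algebra add.commute)
  then show "z + 1 / a \<in> spectrum D L" "x \<in> eigenspace D L (z + 1 / a)"
    using xD x by (auto simp: spectrum_def eigenspace_def)
qed

text \<open>Writing \<open>(L - z)\<^sup>-\<^sup>1 = K (1 - z K)\<^sup>-\<^sup>1\<close> with \<open>K = L\<^sup>-\<^sup>1\<close>, compactness and normality pass
  from \<open>K\<close> to the resolvent.\<close>

lemma obtain_adjoint_of_resolvent: obtains T' where "compact_normal (resolvent z) T'"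
proof -
  define K where "K = inv_into D L"
  obtain K' where "compact_normal K K'" unfolding K_def by (rule obtain_adjoint_of_inverse)
  then interpret K: compact_normal K K' .
  have inj: "x = z *\<^sub>C K x \<Longrightarrow> x = 0" for x unfolding K_def by (rule inverse_inj[OF z])
  define B where "B x = x - z *\<^sub>C K x" for x
  define B' where "B' x = x - cnj z *\<^sub>C K' x" for x
  obtain c where c: "c > 0" and below: "\<And>x. c * norm x \<le> norm (B x)"
    using K.id_minus_bounded_below[OF inj] unfolding B_def by blast
  have adj: "cinner (B x) y = cinner x (B' y)" for x y
    by (simp add: B_def B'_def cinner_algebra K.adjoint)
  have BB': "B (B' x) = B' (B x)" for x
    by (simp add: B_def B'_def K.T.diff K.T'.diff K.scaleC K.adjoint_scaleC K.commute scaleC_algebra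
        scaleC_scaleC mult.commute)
  have KB: "K (B x) = B (K x)" "K (B' x) = B' (K x)" "K' (B x) = B (K' x)" "K' (B' x) = B' (K' x)" for x
    by (simp_all add: B_def B'_def K.T.diff K.T'.diff K.scaleC K.adjoint_scaleC K.commute)
  have B'_inj: "x = y" if "B' x = B' y" for x y
  proof -
    have "B' (x - y) = 0" using that by (simp add: B'_def K.T'.diff scaleC_algebra algebra_simps)
    moreover have "cinner (B u) (B u) = cinner u (B (B' u))" for u by (simp add: adj BB')
    moreover have "B 0 = 0" by (simp add: B_def K.T.zero)
    ultimately have "cinner (B (x - y)) (B (x - y)) = 0" by simp
    then have "B (x - y) = 0" by (simp add: cinner_eq_zero_iff)
    then show ?thesis using below[of "x - y"] c by (simp add: mult_le_0_iff)
  qed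
  have "\<exists>a. B' (B a) = y" for y
    using K.id_minus_normal_surj[OF inj] unfolding B_def B'_def by blast
  \<comment> \<open>As \<open>X\<close> inverts \<open>B' B = B B'\<close>, the inverse of \<open>B\<close> is \<open>B' X\<close> and that of \<open>B'\<close> is \<open>B X\<close>.\<close>
  then obtain X where X: "\<And>y. B' (B (X y)) = y" by metis
  have R: "resolvent z (B a) = K a" for a
    by (rule resolvent_eqI) (simp_all add: K_def inverse_in_D B_def)
  define T' where "T' y = K' (B (X y))" for y
  have T'_B': "T' (B' b) = K' b" for b
    using B'_inj[OF X[of "B' b"]] by (simp add: T'_def)
  have "compact_normal (resolvent z) T'"
  proof
    show "resolvent z (x + y) = resolvent z x + resolvent z y" for x y by (rule resolvent_add)
    show "resolvent z (a *\<^sub>C x) = a *\<^sub>C resolvent z x" for a x by (rule resolvent_scaleC)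
    show "cinner (resolvent z x) y = cinner x (T' y)" for x y
    proof -
      have "cinner (resolvent z (B (B' (X x)))) (B' (B (X y))) = cinner (B (B' (X x))) (T' (B' (B (X y))))"
        unfolding R T'_B' by (simp only: adj[symmetric] KB(1)[symmetric] K.adjoint)
      then show ?thesis by (simp add: BB' X)
    qed
    show "resolvent z (T' y) = T' (resolvent z y)" for y
    proof -
      have "resolvent z (T' y) = K (K' (X y))" unfolding T'_def KB R ..
      moreover have "resolvent z y = B' (K (X y))" by (metis BB' X R KB(2))
      ultimately show ?thesis by (simp add: T'_B' K.commute)
    qed
    fix f :: "nat \<Rightarrow> 'v" assume "bounded (range f)"
    then obtain C where C: "\<And>n. norm (f n) \<le> C" unfolding bounded_iff by auto
    define g where "g n = B' (X (f n))" for n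
    have g: "B (g n) = f n" for n by (simp add: g_def BB' X)
    have "norm (g n) \<le> C / c" for n
      using below[of "g n"] C[of n] c by (simp add: g le_divide_eq mult.commute)
    then have "bounded (range g)" unfolding bounded_iff by blast
    then have "\<exists>l r. strict_mono r \<and> (\<lambda>n. K (g (r n))) \<longlonglongrightarrow> l" by (rule K.compact)
    then show "\<exists>l r. strict_mono r \<and> (\<lambda>n. resolvent z (f (r n))) \<longlonglongrightarrow> l"
      by (simp flip: g add: R)
  qed
  then show thesis using that by blast
qed

lemma bounded_linear_resolvent: "bounded_linear (resolvent z)"
proof -
  obtain T' where "compact_normal (resolvent z) T'" by (rule obtain_adjoint_of_resolvent)
  then show ?thesis by (rule compact_normal.bounded_linear)
qed

lemma resolvent_orth_to_eigenspaces:
  assumes F: "F \<subseteq> spectrum D L" and x: "x \<in> orth_to_eigenspaces F"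
  shows "resolvent z x \<in> orth_to_eigenspaces F"
proof -
  obtain T' where "compact_normal (resolvent z) T'" by (rule obtain_adjoint_of_resolvent)
  then interpret T: compact_normal "resolvent z" T' .
  have "cinner (resolvent z x) e = 0" if "l \<in> F" "e \<in> eigenspace D L l" for l e
  proof -
    have "resolvent z e = (1 / (l - z)) *\<^sub>C e" using that F by (intro resolvent_eigenvector) auto
    from T.eigenvector_adjoint[OF this] show ?thesis
      using x that by (simp add: T.adjoint cinner_algebra orth_to_eigenspaces_def)
  qed
  then show ?thesis by (simp add: orth_to_eigenspaces_def)
qed

text \<open>On the orthogonal complement of the eigenspaces for \<open>F\<close> the eigenvalues of the resolvent are
  the numbers \<open>1 / (l - z)\<close> for the remaining \<open>l\<close>, and the norm of a compact normal operator
  is the largest modulus of an eigenvalue. For \<open>F = {}\<close> this bounds the resolvent by the inverse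
  distance from \<open>z\<close> to the spectrum.\<close>

lemma norm_resolvent_le:
  assumes F: "F \<subseteq> spectrum D L" and x: "x \<in> orth_to_eigenspaces F"
    and \<rho>: "\<rho> > 0" and far: "\<And>l. l \<in> spectrum D L - F \<Longrightarrow> \<rho> \<le> cmod (l - z)"
  shows "norm (resolvent z x) \<le> norm x / \<rho>"
proof -
  obtain T' where "compact_normal (resolvent z) T'" by (rule obtain_adjoint_of_resolvent)
  then interpret T: compact_normal "resolvent z" T' .
  have "norm (resolvent z x) \<le> 1 / \<rho> * norm x"
  proof (rule T.norm_le_eigenvalue_bound[OF _ _ _ _ _ _ x])
    show "complex_subspace (orth_to_eigenspaces F)"
      by (auto simp: complex_subspace_def orth_to_eigenspaces_def cinner_algebra)
    have "orth_to_eigenspaces F = (\<Inter>l\<in>F. \<Inter>e\<in>eigenspace D L l. {y. cinner y e = 0})"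
      by (auto simp: orth_to_eigenspaces_def)
    then show "closed (orth_to_eigenspaces F)"
      by (auto intro!: closed_INT closed_Collect_eq continuous_intros
          bounded_bilinear.continuous_on[OF bounded_bilinear_cinner])
    show "resolvent z y \<in> orth_to_eigenspaces F" if "y \<in> orth_to_eigenspaces F" for y
      using F that by (rule resolvent_orth_to_eigenspaces)
    show "T' y \<in> orth_to_eigenspaces F" if y: "y \<in> orth_to_eigenspaces F" for y
    proof -
      have "cinner (T' y) e = 0" if "l \<in> F" "e \<in> eigenspace D L l" for l e
      proof -
        have "resolvent z e = (1 / (l - z)) *\<^sub>C e" using that F by (intro resolvent_eigenvector) auto
        then show ?thesis using y that by (simp add: T.adjoint' cinner_algebra orth_to_eigenspaces_def)
      qed
      then show ?thesis by (simp add: orth_to_eigenspaces_def)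
    qed
    show "cmod a \<le> 1 / \<rho>" if y: "y \<in> orth_to_eigenspaces F" "y \<noteq> 0" "resolvent z y = a *\<^sub>C y" for y a
    proof -
      note ev = resolvent_eigenvalue[OF y(2,3)]
      have "z + 1 / a \<notin> F"
        using y(1,2) ev(3) cinner_eq_zero_iff[of y] by (auto simp: orth_to_eigenspaces_def)
      then have "\<rho> \<le> cmod (1 / a)" using far[of "z + 1 / a"] ev by simp
      then show ?thesis using \<rho> ev(1) by (simp add: norm_divide field_simps)
    qed
  qed (use \<rho> in auto)
  then show ?thesis by simp
qed

end

lemma resolvent_identity:
  assumes "z \<notin> spectrum D L" "z0 \<notin> spectrum D L"
  shows "resolvent z x = resolvent z0 x + (z - z0) *\<^sub>C resolvent z (resolvent z0 x)"
proof -
  define s where "s = resolvent z0 x"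
  define t where "t = resolvent z x"
  have s: "s \<in> D" "L s - z0 *\<^sub>C s = x" unfolding s_def using assms
    by (auto simp: resolvent_in_D L_resolvent)
  have t: "t \<in> D" "L t - z *\<^sub>C t = x" unfolding t_def using assms
    by (auto simp: resolvent_in_D L_resolvent)
  have "L (t - s) - z *\<^sub>C (t - s) = (L t - z *\<^sub>C t) - (L s - z0 *\<^sub>C s) + (z - z0) *\<^sub>C s"
    using s(1) t(1) by (simp add: L_diff scaleC_algebra)
  also have "\<dots> = (z - z0) *\<^sub>C s" using s t by simp
  finally have "resolvent z ((z - z0) *\<^sub>C s) = t - s"
    using D_diff s t by (intro resolvent_eqI assms) auto
  then have "t = s + (z - z0) *\<^sub>C resolvent z s" using assms by (simp add: resolvent_scaleC)
  then show ?thesis by (simp add: s_def t_def)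
qed

text \<open>Unit eigenvectors \<open>e\<^sub>n\<close> for distinct eigenvalues \<open>l\<^sub>n\<close> are orthogonal, so the vectors
  \<open>L\<^sup>-\<^sup>1 e\<^sub>n = e\<^sub>n / l\<^sub>n\<close> stay apart as long as the \<open>l\<^sub>n\<close> stay bounded. By compactness
  this is possible for finitely many of them only.\<close>

lemma finite_spectrum_cball: "finite (spectrum D L \<inter> cball 0 r)"
proof (rule ccontr)
  assume inf: "infinite (spectrum D L \<inter> cball 0 r)"
  define K where "K = inv_into D L"
  obtain K' where "compact_normal K K'" unfolding K_def by (rule obtain_adjoint_of_inverse)
  then interpret K: compact_normal K K' .
  obtain l :: "nat \<Rightarrow> complex" where l: "inj l" "range l \<subseteq> spectrum D L \<inter> cball 0 r"
    using infinite_countable_subset[OF inf] by blast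
  have "\<exists>e\<in>D. norm e = 1 \<and> L e = l n *\<^sub>C e" for n
  proof -
    obtain v where v: "v \<in> D" "v \<noteq> 0" "L v = l n *\<^sub>C v" using l(2) by (force simp: spectrum_def)
    define e where "e = complex_of_real (1 / norm v) *\<^sub>C v"
    have "e \<in> D" "L e = l n *\<^sub>C e"
      using v by (auto simp: e_def D_scaleC L_scaleC scaleC_scaleC mult.commute)
    moreover have "norm e = 1" using v by (simp add: e_def norm_divide)
    ultimately show ?thesis by blast
  qed
  then obtain e where e: "\<And>n. e n \<in> D" "\<And>n. norm (e n) = 1" "\<And>n. L (e n) = l n *\<^sub>C e n" by metis
  have l0: "l n \<noteq> 0" for n
  proof
    assume "l n = 0"
    then have "K (L (e n)) = K 0" using e(3)[of n] by simp
    then have "e n = 0" using e(1) inverse_L K.T.zero by (simp add: K_def)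
    then show False using e(2)[of n] by simp
  qed
  have Ke: "K (e n) = (1 / l n) *\<^sub>C e n" for n
  proof -
    have "e n = K (l n *\<^sub>C e n)" using e inverse_L by (metis K_def)
    then have "(1 / l n) *\<^sub>C e n = (1 / l n) *\<^sub>C (l n *\<^sub>C K (e n))" by (simp add: K.scaleC)
    then show ?thesis using l0 by (simp add: scaleC_scaleC)
  qed
  have orth: "cinner (e m) (e n) = 0" if "m \<noteq> n" for m n
  proof -
    have "1 / l m * cinner (e m) (e n) = cinner (K (e m)) (e n)" by (simp add: Ke cinner_algebra)
    also have "\<dots> = 1 / l n * cinner (e m) (e n)"
      using K.eigenvector_adjoint[OF Ke[of n]] by (simp add: K.adjoint cinner_algebra)
    finally show ?thesis using l(1) that by (auto dest: injD)
  qed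
  have r: "r > 0" using l(2) l0[of 0] by (force intro: less_le_trans[of 0 "norm (l 0)"])
  have apart: "norm (K (e m) - K (e n)) \<ge> 1 / r" if "m \<noteq> n" for m n
  proof (rule power2_le_imp_le)
    have "cmod (l m) \<le> r" using l(2) by force
    then have "1 / r \<le> 1 / cmod (l m)" using l0 by (intro divide_left_mono) (auto simp: r)
    then have "(1 / r)\<^sup>2 \<le> (1 / cmod (l m))\<^sup>2" using r by (intro power_mono) auto
    also have "\<dots> \<le> (norm (K (e m) - K (e n)))\<^sup>2"
      by (simp add: norm_diff_square Ke cinner_algebra orth[OF that] norm_divide e(2))
    finally show "(1 / r)\<^sup>2 \<le> (norm (K (e m) - K (e n)))\<^sup>2" .
  qed simp
  have "bounded (range e)" unfolding bounded_iff using e(2) by force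
  then obtain y k where k: "strict_mono k" and y: "(\<lambda>n. K (e (k n))) \<longlonglongrightarrow> y" using K.compact[of e] by blast
  have "(\<lambda>n. norm (K (e (k (Suc n))) - K (e (k n)))) \<longlonglongrightarrow> norm (y - y)"
    by (intro tendsto_norm tendsto_diff y LIMSEQ_Suc[OF y])
  moreover have "norm (K (e (k (Suc n))) - K (e (k n))) \<ge> 1 / r" for n
    using k by (intro apart) (simp add: strict_mono_eq)
  ultimately have "1 / r \<le> norm (y - y)" by (intro LIMSEQ_le_const) auto
  then show False using r by simp
qed

end

section \<open>Taylor coefficients of vector-valued power series\<close>

definition has_taylor_series :: "(complex \<Rightarrow> 'v::complex_hilbert) \<Rightarrow> complex \<Rightarrow> (nat \<Rightarrow> 'v) \<Rightarrow> bool" where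
  "has_taylor_series F z0 a \<longleftrightarrow> (\<exists>r>0. \<forall>z\<in>ball z0 r. (\<lambda>n. (z - z0) ^ n *\<^sub>C a n) sums F z)"

lemma complex_deriv_eqI:
  fixes F :: "complex \<Rightarrow> 'v::complex_hilbert"
  assumes "(F has_derivative (\<lambda>h. h *\<^sub>C d)) (at z)"
  shows "complex_deriv F z = d"
  unfolding complex_deriv_def
proof (rule tendsto_Lim)
  have "((\<lambda>w. norm (F w - F z - (w - z) *\<^sub>C d) / norm (w - z)) \<longlongrightarrow> 0) (at z)"
    using assms unfolding has_derivative_iff_norm by blast
  moreover have "\<forall>\<^sub>F w in at z. norm (F w - F z - (w - z) *\<^sub>C d) / norm (w - z)
      = norm (inverse (w - z) *\<^sub>C (F w - F z) - d)"
  proof (rule eventually_at_topological[THEN iffD2, OF exI[of _ UNIV]], safe)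
    fix w assume "w \<noteq> z"
    then have "inverse (w - z) *\<^sub>C (F w - F z) - d = inverse (w - z) *\<^sub>C (F w - F z - (w - z) *\<^sub>C d)"
      by (simp add: scaleC_diff_right[of _ "F w - F z"] scaleC_scaleC)
    then show "norm (F w - F z - (w - z) *\<^sub>C d) / norm (w - z) = norm (inverse (w - z) *\<^sub>C (F w - F z) - d)"
      by (simp add: norm_inverse divide_inverse mult.commute)
  qed auto
  ultimately have "((\<lambda>w. norm (inverse (w - z) *\<^sub>C (F w - F z) - d)) \<longlongrightarrow> 0) (at z)"
    by (rule Lim_transform_eventually)
  then show "((\<lambda>w. inverse (w - z) *\<^sub>C (F w - F z)) \<longlongrightarrow> d) (at z)"
    using Lim_null tendsto_norm_zero_iff by blast
qed simp

text \<open>Termwise differentiation. If the series converges on the disc of radius \<open>r\<close>, its terms are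
  bounded at distance \<open>r / 2\<close> from the centre; on the disc of radius \<open>r / 4\<close> the terms of the
  derived series are therefore dominated by a multiple of \<open>(n + 1) / 2\<^sup>n\<close>, and it converges
  uniformly.\<close>

lemma has_taylor_series_deriv:
  fixes F :: "complex \<Rightarrow> 'v::complex_hilbert"
  assumes "has_taylor_series F z0 a"
  shows "has_taylor_series (complex_deriv F) z0 (\<lambda>n. of_nat (Suc n) *\<^sub>C a (Suc n))"
proof -
  obtain r where r: "r > 0" and F: "\<And>z. z \<in> ball z0 r \<Longrightarrow> (\<lambda>n. (z - z0) ^ n *\<^sub>C a n) sums F z"
    using assms unfolding has_taylor_series_def by blast
  define \<rho> where "\<rho> = r / 2"
  have \<rho>: "\<rho> > 0" using r by (simp add: \<rho>_def)
  define s where "s = \<rho> / 2"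
  have s: "s > 0" "s < r" using r by (simp_all add: s_def \<rho>_def)
  define b where "b n = of_nat (Suc n) *\<^sub>C a (Suc n)" for n
  have "z0 + of_real \<rho> \<in> ball z0 r" using r by (simp add: dist_norm \<rho>_def)
  from summable_LIMSEQ_zero[OF sums_summable[OF F[OF this]]]
  have "(\<lambda>n. of_real (\<rho> ^ n) *\<^sub>C a n) \<longlonglongrightarrow> 0" by simp
  from convergent_imp_bounded[OF this] obtain C where "\<And>n. norm (of_real (\<rho> ^ n) *\<^sub>C a n) \<le> C"
    unfolding bounded_iff by auto
  then have C: "norm (a n) \<le> C / \<rho> ^ n" for n using \<rho> by (simp add: le_divide_eq mult.commute norm_power)
  have C0: "C \<ge> 0" using order_trans[OF norm_ge_zero C[of 0]] by simp
  have M: "norm ((z - z0) ^ n *\<^sub>C b n) \<le> C / \<rho> * (of_nat (Suc n) * (1/2) ^ n)" if z: "z \<in> ball z0 s" for z n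
  proof -
    have "cmod (z - z0) \<le> s" using z by (simp add: dist_norm norm_minus_commute)
    then have "cmod (z - z0) ^ n \<le> s ^ n" by (intro power_mono) auto
    moreover have "of_nat (Suc n) * norm (a (Suc n)) \<le> of_nat (Suc n) * (C / \<rho> ^ Suc n)"
      by (rule mult_left_mono[OF C]) simp
    ultimately have "cmod (z - z0) ^ n * (of_nat (Suc n) * norm (a (Suc n)))
        \<le> s ^ n * (of_nat (Suc n) * (C / \<rho> ^ Suc n))"
      by (rule mult_mono) (use s in auto)
    moreover have "norm ((z - z0) ^ n *\<^sub>C b n) = cmod (z - z0) ^ n * (of_nat (Suc n) * norm (a (Suc n)))"
      unfolding b_def norm_scaleC norm_power norm_of_nat ..
    ultimately have "norm ((z - z0) ^ n *\<^sub>C b n) \<le> s ^ n * (of_nat (Suc n) * (C / \<rho> ^ Suc n))" by simp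
    also have "\<dots> = C / \<rho> * (of_nat (Suc n) * (1/2) ^ n)"
    proof -
      have "s ^ n = \<rho> ^ n * (1/2) ^ n" by (simp add: s_def power_divide)
      moreover have "\<rho> ^ n * h * (k * (C / (\<rho> * \<rho> ^ n))) = C / \<rho> * (k * h)" for h k
        using \<rho> by simp
      ultimately show ?thesis by simp
    qed
    finally show ?thesis .
  qed
  have M_summable: "summable (\<lambda>n. C / \<rho> * (of_nat (Suc n) * (1/2) ^ n))"
    using geometric_deriv_sums[of "1/2 :: real"] by (intro summable_mult) (auto simp: sums_iff)
  define G where "G z = (\<Sum>n. (z - z0) ^ n *\<^sub>C b n)" for z
  have unif: "uniform_limit (ball z0 s) (\<lambda>n z. \<Sum>i<n. (z - z0) ^ i *\<^sub>C b i) G sequentially"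
    unfolding G_def by (rule Weierstrass_m_test[OF M M_summable])
  have G: "(\<lambda>n. (z - z0) ^ n *\<^sub>C b n) sums G z" if "z \<in> ball z0 s" for z
    unfolding G_def by (intro summable_sums summable_comparison_test[OF _ M_summable]) (use M[OF that] in blast)
  \<comment> \<open>The derived terms start with a zero for \<open>n = 0\<close>, hence the shift by one in the partial sums.\<close>
  have "\<exists>g. \<forall>z\<in>ball z0 s. (\<lambda>n. (z - z0) ^ n *\<^sub>C a n) sums g z
      \<and> (g has_derivative (\<lambda>h. h *\<^sub>C G z)) (at z within ball z0 s)"
  proof (rule has_derivative_series[where f' = "\<lambda>n z h. (h * (of_nat n * (z - z0) ^ (n - 1))) *\<^sub>C a n"])
    show "(\<lambda>n. (z0 - z0) ^ n *\<^sub>C a n) sums F z0" using F[of z0] r by simp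
    fix n z
    have "((\<lambda>z. (z - z0) ^ n) has_derivative (\<lambda>h. h * (of_nat n * (z - z0) ^ (n - 1)))) (at z within ball z0 s)"
      by (auto intro!: derivative_eq_intros simp: mult.commute)
    then show "((\<lambda>z. (z - z0) ^ n *\<^sub>C a n) has_derivative
        (\<lambda>h. (h * (of_nat n * (z - z0) ^ (n - 1))) *\<^sub>C a n)) (at z within ball z0 s)"
      by (rule bounded_linear.has_derivative[OF bounded_bilinear.bounded_linear_left[OF bounded_bilinear_scaleC]])
  next
    fix e :: real assume "e > 0"
    with unif have "\<forall>\<^sub>F n in sequentially. \<forall>z\<in>ball z0 s. dist (\<Sum>i<n. (z - z0) ^ i *\<^sub>C b i) (G z) < e"
      by (rule uniform_limitD)
    then have ev: "\<forall>\<^sub>F n in sequentially. \<forall>z\<in>ball z0 s. \<forall>h.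
        norm ((\<Sum>i<Suc n. (h * (of_nat i * (z - z0) ^ (i - 1))) *\<^sub>C a i) - h *\<^sub>C G z) \<le> e * norm h"
    proof (eventually_elim, intro ballI allI)
      fix n z h assume d: "\<forall>z\<in>ball z0 s. dist (\<Sum>i<n. (z - z0) ^ i *\<^sub>C b i) (G z) < e" and z: "z \<in> ball z0 s"
      have "(\<Sum>i<Suc n. (h * (of_nat i * (z - z0) ^ (i - 1))) *\<^sub>C a i) = h *\<^sub>C (\<Sum>i<n. (z - z0) ^ i *\<^sub>C b i)"
        by (subst sum.lessThan_Suc_shift)
          (simp add: b_def scaleC_sum_right scaleC_scaleC mult_ac del: of_nat_Suc)
      then have "norm ((\<Sum>i<Suc n. (h * (of_nat i * (z - z0) ^ (i - 1))) *\<^sub>C a i) - h *\<^sub>C G z)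
          = norm h * norm ((\<Sum>i<n. (z - z0) ^ i *\<^sub>C b i) - G z)"
        by (simp flip: scaleC_diff_right)
      also have "\<dots> \<le> norm h * e" using d z by (intro mult_left_mono) (auto simp: dist_norm intro: less_imp_le)
      finally show "norm ((\<Sum>i<Suc n. (h * (of_nat i * (z - z0) ^ (i - 1))) *\<^sub>C a i) - h *\<^sub>C G z) \<le> e * norm h"
        by (simp add: mult.commute)
    qed
    then show "\<forall>\<^sub>F n in sequentially. \<forall>z\<in>ball z0 s. \<forall>h.
        norm ((\<Sum>i<n. (h * (of_nat i * (z - z0) ^ (i - 1))) *\<^sub>C a i) - h *\<^sub>C G z) \<le> e * norm h"
      by (subst (asm) eventually_sequentially_Suc)
  qed (use s in auto)
  then obtain g where g: "\<And>z. z \<in> ball z0 s \<Longrightarrow> (\<lambda>n. (z - z0) ^ n *\<^sub>C a n) sums g z"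
    and g': "\<And>z. z \<in> ball z0 s \<Longrightarrow> (g has_derivative (\<lambda>h. h *\<^sub>C G z)) (at z within ball z0 s)" by blast
  have "complex_deriv F z = G z" if z: "z \<in> ball z0 s" for z
  proof (rule complex_deriv_eqI)
    have "g y = F y" if "y \<in> ball z0 s" for y
      using sums_unique2[OF g[OF that] F] that s by simp
    then have "(F has_derivative (\<lambda>h. h *\<^sub>C G z)) (at z within ball z0 s)"
      using has_derivative_transform[OF z _ g'[OF z]] by metis
    then show "(F has_derivative (\<lambda>h. h *\<^sub>C G z)) (at z)"
      using z by (simp add: at_within_open[of z "ball z0 s"])
  qed
  then show ?thesis
    unfolding has_taylor_series_def b_def[symmetric] using s G by auto
qed

lemma taylor_coeff_eqI:
  fixes F :: "complex \<Rightarrow> 'v::complex_hilbert"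
  assumes "has_taylor_series F z0 a"
  shows "taylor_coeff F n z0 = a n"
proof -
  have "has_taylor_series ((complex_deriv ^^ k) F) z0 (\<lambda>n. (fact (n + k) / fact n) *\<^sub>C a (n + k))" for k
  proof (induction k)
    case 0
    then show ?case using assms by simp
  next
    case (Suc k)
    have "of_nat (Suc n) * (fact (Suc n + k) / fact (Suc n)) = (fact (n + Suc k) / fact n :: complex)" for n
      by (simp add: field_simps del: of_nat_Suc fact_Suc) (simp add: algebra_simps)
    then show ?case using has_taylor_series_deriv[OF Suc] by (simp add: scaleC_scaleC del: of_nat_Suc fact_Suc)
  qed
  then obtain r where "r > 0" and "\<And>z. z \<in> ball z0 r \<Longrightarrow>
      (\<lambda>i. (z - z0) ^ i *\<^sub>C (fact (i + n) / fact i) *\<^sub>C a (i + n)) sums (complex_deriv ^^ n) F z"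
    unfolding has_taylor_series_def by blast
  then have "(\<lambda>i. (z0 - z0) ^ i *\<^sub>C (fact (i + n) / fact i) *\<^sub>C a (i + n)) sums (complex_deriv ^^ n) F z0"
    using centre_in_ball by blast
  moreover have "(\<lambda>i. (z0 - z0) ^ i *\<^sub>C (fact (i + n) / fact i) *\<^sub>C a (i + n)) sums (fact n *\<^sub>C a n)"
    using sums_finite[of "{0}" "\<lambda>i. (z0 - z0) ^ i *\<^sub>C (fact (i + n) / fact i) *\<^sub>C a (i + n)"]
    by (simp add: power_0_left)
  ultimately have "(complex_deriv ^^ n) F z0 = fact n *\<^sub>C a n" by (rule sums_unique2)
  then show ?thesis by (simp add: taylor_coeff_def scaleC_scaleC)
qed

section \<open>Lower bounds for normalised polynomials\<close>

text \<open>Induction on the degree: a linear factor \<open>w - r\<close> increases the coefficients by a factor of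
  at most \<open>1 + \<bar>r\<bar>\<close>, while on \<open>\<bar>w\<bar> < R\<close> and off the disc of radius \<open>\<eta>\<close> around \<open>r\<close> its modulus is at
  least a fixed multiple \<open>\<kappa>\<close> of \<open>1 + \<bar>r\<bar>\<close>. For small \<open>r\<close> the reason is \<open>\<eta> \<le> \<bar>w - r\<bar>\<close>; for large
  \<open>r\<close> it is \<open>\<bar>w - r\<bar> \<ge> \<bar>r\<bar> - R\<close>.\<close>

lemma poly_lower_bound_off_discs:
  fixes R \<eta> :: real
  assumes R: "R > 0" and \<eta>: "\<eta> > 0"
  shows "\<exists>c>0. \<forall>p :: complex poly. degree p \<le> N \<longrightarrow>
    (\<exists>Z. finite Z \<and> card Z \<le> N \<and>
      (\<forall>w j. cmod w < R \<longrightarrow> (\<forall>r\<in>Z. \<eta> \<le> cmod (w - r)) \<longrightarrow> c * cmod (coeff p j) \<le> cmod (poly p w)))"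
proof (induction N)
  case 0
  have "1 * cmod (coeff p j) \<le> cmod (poly p w)" if deg: "degree p \<le> 0" for p :: "complex poly" and w j
  proof -
    obtain a where "p = [:a:]" using deg degree_eq_zeroE[of p] by blast
    then show ?thesis by (cases j) auto
  qed
  then show ?case by (intro exI[of _ 1]) (auto intro: exI[of _ "{}"])
next
  case (Suc N)
  then obtain c where c: "c > 0" and IH: "\<And>p :: complex poly. degree p \<le> N \<Longrightarrow>
    \<exists>Z. finite Z \<and> card Z \<le> N \<and>
      (\<forall>w j. cmod w < R \<longrightarrow> (\<forall>r\<in>Z. \<eta> \<le> cmod (w - r)) \<longrightarrow> c * cmod (coeff p j) \<le> cmod (poly p w))"
    by blast
  define \<kappa> where "\<kappa> = min (1 / 2) (\<eta> / (2 * R + 2))"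
  have \<kappa>: "\<kappa> > 0" using R \<eta> by (simp add: \<kappa>_def)
  have \<kappa>_le: "\<kappa> \<le> 1 / 2" "\<kappa> \<le> \<eta> / (2 * R + 2)"
    unfolding \<kappa>_def by (rule min.cobounded1, rule min.cobounded2)
  have factor: "\<kappa> * (1 + cmod r) \<le> cmod (w - r)" if w: "cmod w < R" "\<eta> \<le> cmod (w - r)" for w r
  proof (cases "cmod r \<le> 2 * R + 1")
    case True
    then have "\<kappa> * (1 + cmod r) \<le> \<eta> / (2 * R + 2) * (2 * R + 2)" using R \<eta> \<kappa>_le by (intro mult_mono) auto
    also have "\<dots> = \<eta>" using R by simp
    finally show ?thesis using w by simp
  next
    case False
    have "\<kappa> * (1 + cmod r) \<le> 1 / 2 * (1 + cmod r)" using \<kappa>_le by (intro mult_right_mono) auto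
    also have "\<dots> \<le> cmod r - cmod w" using False w by simp
    also have "\<dots> \<le> cmod (w - r)" by (metis norm_minus_commute norm_triangle_ineq2)
    finally show ?thesis .
  qed
  show ?case
  proof (intro exI[of _ "c * \<kappa>"] conjI allI impI)
    show "c * \<kappa> > 0" using c \<kappa> by simp
    fix p :: "complex poly" assume deg: "degree p \<le> Suc N"
    show "\<exists>Z. finite Z \<and> card Z \<le> Suc N \<and> (\<forall>w j. cmod w < R \<longrightarrow> (\<forall>r\<in>Z. \<eta> \<le> cmod (w - r))
        \<longrightarrow> c * \<kappa> * cmod (coeff p j) \<le> cmod (poly p w))"
    proof (cases "degree p \<le> N")
      case True
      have "c * \<kappa> * cmod (coeff p j) \<le> c * cmod (coeff p j)" for j
        using c \<kappa>_le mult_left_mono[of \<kappa> 1 c] by (intro mult_right_mono) auto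
      moreover obtain Z where "finite Z" "card Z \<le> N"
        and "\<And>w j. cmod w < R \<Longrightarrow> (\<forall>r\<in>Z. \<eta> \<le> cmod (w - r)) \<Longrightarrow> c * cmod (coeff p j) \<le> cmod (poly p w)"
        using IH[OF True] by blast
      ultimately show ?thesis by (intro exI[of _ Z]) (auto intro: order_trans)
    next
      case False
      then have "degree p = Suc N" using deg by simp
      then have "\<not> constant (poly p)" by (simp add: constant_degree)
      then obtain r where "poly p r = 0" using fundamental_theorem_of_algebra by blast
      then obtain q where p: "p = [:- r, 1:] * q" unfolding poly_eq_0_iff_dvd by (auto elim: dvdE)
      have "q \<noteq> 0" using p \<open>degree p = Suc N\<close> by auto
      then have "degree q = N" 
        using \<open>degree p = Suc N\<close> degree_mult_eq[of "[:- r, 1:]" q] unfolding p by simp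
      then obtain Z where Z: "finite Z" "card Z \<le> N"
        and q: "\<And>w j. cmod w < R \<Longrightarrow> (\<forall>r\<in>Z. \<eta> \<le> cmod (w - r)) \<Longrightarrow> c * cmod (coeff q j) \<le> cmod (poly q w)"
        using IH[of q] by auto
      have "c * \<kappa> * cmod (coeff p j) \<le> cmod (poly p w)"
        if w: "cmod w < R" "\<forall>x\<in>insert r Z. \<eta> \<le> cmod (w - x)" for w j
      proof -
        have q: "c * cmod (coeff q j) \<le> cmod (poly q w)" for j using q w by simp
        have "coeff p j = coeff (pCons 0 q) j - r * coeff q j" by (simp add: p)
        moreover have "c * cmod (coeff (pCons 0 q) j) \<le> cmod (poly q w)"
          using q[of "j - 1"] by (cases j) auto
        moreover have "c * cmod (r * coeff q j) \<le> cmod r * cmod (poly q w)"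
          using mult_left_mono[OF q[of j], of "cmod r"] by (simp add: norm_mult mult_ac)
        moreover have "c * cmod (coeff (pCons 0 q) j - r * coeff q j)
            \<le> c * (cmod (coeff (pCons 0 q) j) + cmod (r * coeff q j))"
          using c by (intro mult_left_mono norm_triangle_ineq4) auto
        ultimately have "c * cmod (coeff p j) \<le> (1 + cmod r) * cmod (poly q w)"
          by (simp add: distrib_left distrib_right)
        from mult_left_mono[OF this, of \<kappa>]
        have "c * \<kappa> * cmod (coeff p j) \<le> (\<kappa> * (1 + cmod r)) * cmod (poly q w)" using \<kappa> by (simp add: mult_ac)
        also have "\<dots> \<le> cmod (w - r) * cmod (poly q w)" using factor w by (intro mult_right_mono) auto
        also have "\<dots> = cmod (poly p w)" by (simp add: p flip: norm_mult) (simp add: algebra_simps)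
        finally show ?thesis .
      qed
      moreover have "finite (insert r Z)" "card (insert r Z) \<le> Suc N"
        using Z by (auto simp: card_insert_if)
      ultimately show ?thesis by blast
    qed
  qed
qed

lemma emeasure_discs_le:
  fixes A :: "complex set"
  assumes A: "finite A" "card A \<le> K" and \<eta>: "\<eta> \<ge> 0" and \<delta>: "real K * (pi * \<eta>\<^sup>2) \<le> \<delta>"
  shows "emeasure lebesgue (\<Union>x\<in>A. ball x \<eta>) \<le> ennreal \<delta>"
proof -
  have "emeasure lebesgue (\<Union>x\<in>A. ball x \<eta>) \<le> (\<Sum>x\<in>A. emeasure lebesgue (ball x \<eta>))"
    by (intro emeasure_subadditive_finite A) auto
  also have "\<dots> = (\<Sum>x\<in>A. ennreal (pi * \<eta>\<^sup>2))"
    using \<eta> by (intro sum.cong refl) (simp add: emeasure_ball unit_ball_vol_2)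
  also have "\<dots> = ennreal (real (card A) * (pi * \<eta>\<^sup>2))"
    by (simp add: ennreal_mult' ennreal_of_nat_eq_real_of_nat)
  also have "real (card A) * (pi * \<eta>\<^sup>2) \<le> \<delta>"
    using A(2) by (intro order_trans[OF mult_right_mono \<delta>]) auto
  finally show ?thesis by (simp add: ennreal_leI)
qed

lemma unit_coefficients_lower_bound:
  fixes q :: "nat \<Rightarrow> complex"
  assumes "(\<Sum>j\<le>N. (cmod (q j))\<^sup>2) = 1"
  obtains j where "j \<le> N" "1 / real (Suc N) \<le> cmod (q j)"
proof -
  have "\<exists>j\<le>N. 1 / real (Suc N) \<le> cmod (q j)"
  proof (rule ccontr)
    assume "\<not> ?thesis"
    then have small: "cmod (q j) < 1 / real (Suc N)" if "j \<le> N" for j using that by (meson not_le)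
    have "(\<Sum>j\<le>N. (cmod (q j))\<^sup>2) < (\<Sum>j\<le>N. (1 / real (Suc N))\<^sup>2)"
      using small by (intro sum_strict_mono power_strict_mono) auto
    also have "\<dots> = 1 / real (Suc N)" by (simp add: power2_eq_square)
    also have "\<dots> \<le> 1" by simp
    finally show False using assms by simp
  qed
  then show thesis using that by blast
qed

section \<open>The remainder of the Taylor expansion\<close>

lemma sum_shifted_coefficients:
  fixes X :: "nat \<Rightarrow> 'a::comm_monoid_add"
  assumes "j \<le> m"
  shows "(\<Sum>n<m. if j \<le> n then X n else 0) = (\<Sum>i<m - j. X (i + j))"
proof -
  have "(\<Sum>n<m. if j \<le> n then X n else 0) = (\<Sum>n\<in>{j..<m}. X n)"
    by (intro sum.mono_neutral_cong_right) auto
  also have "\<dots> = (\<Sum>i<m - j. X (i + j))"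
    using sum.shift_bounds_nat_ivl[of X 0 j "m - j"] assms by (simp add: atLeast0LessThan)
  finally show ?thesis .
qed

context normal_resolvent
begin

text \<open>The Taylor coefficients at \<open>z0\<close> of \<open>z \<mapsto> (\<Sum>j\<le>N. q\<^sub>j (z - z0)\<^sup>j) (L - z)\<^sup>-\<^sup>1 v\<close>: those of
  \<open>(L - z)\<^sup>-\<^sup>1 v\<close> are \<open>T\<^sup>n\<^sup>+\<^sup>1 v\<close> with \<open>T = (L - z0)\<^sup>-\<^sup>1\<close>.\<close>

definition product_taylor_coeff :: "complex \<Rightarrow> nat \<Rightarrow> (nat \<Rightarrow> complex) \<Rightarrow> 'v \<Rightarrow> nat \<Rightarrow> 'v" where
  "product_taylor_coeff z0 N q v n =
    (\<Sum>j\<le>N. if j \<le> n then q j *\<^sub>C (resolvent z0 ^^ (Suc n - j)) v else 0)"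

text \<open>Up to the factor \<open>(z - z0)\<^sup>M\<^sup>+\<^sup>1\<close>, the remainder of the Taylor polynomial of degree \<open>M\<close> of
  the same map is the resolvent at \<open>z\<close> of this vector. It makes sense for \<open>N \<le> M + 1\<close>. For
  \<open>N \<le> M\<close> it is the Taylor coefficient with index \<open>M\<close>; for \<open>N = M + 1\<close> it has the additional
  summand \<open>q\<^sub>N v\<close>.\<close>

definition remainder_vector :: "complex \<Rightarrow> nat \<Rightarrow> (nat \<Rightarrow> complex) \<Rightarrow> 'v \<Rightarrow> nat \<Rightarrow> 'v" where
  "remainder_vector z0 N q v M = (\<Sum>j\<le>N. q j *\<^sub>C (resolvent z0 ^^ (Suc M - j)) v)"

context
  fixes z0 :: complex
  assumes z0: "z0 \<notin> spectrum D L"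
begin

lemma resolvent_expansion:
  assumes z: "z \<notin> spectrum D L"
  shows "resolvent z v = (\<Sum>i<m. (z - z0) ^ i *\<^sub>C (resolvent z0 ^^ Suc i) v)
           + (z - z0) ^ m *\<^sub>C resolvent z ((resolvent z0 ^^ m) v)"
proof (induction m)
  case (Suc m)
  have "(z - z0) ^ m *\<^sub>C resolvent z ((resolvent z0 ^^ m) v)
      = (z - z0) ^ m *\<^sub>C (resolvent z0 ^^ Suc m) v + (z - z0) ^ Suc m *\<^sub>C resolvent z ((resolvent z0 ^^ Suc m) v)"
    using resolvent_identity[OF z z0, of "(resolvent z0 ^^ m) v"]
    by (simp add: scaleC_add_right scaleC_scaleC mult.commute)
  then show ?case using Suc by simp
qed simp

lemma norm_resolvent_power_le:
  assumes F: "F \<subseteq> spectrum D L" and x: "x \<in> orth_to_eigenspaces F"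
    and \<rho>: "\<rho> > 0" and far: "\<And>l. l \<in> spectrum D L - F \<Longrightarrow> \<rho> \<le> cmod (l - z0)"
  shows "norm ((resolvent z0 ^^ n) x) \<le> norm x / \<rho> ^ n"
proof -
  have "(resolvent z0 ^^ n) x \<in> orth_to_eigenspaces F \<and> norm ((resolvent z0 ^^ n) x) \<le> norm x / \<rho> ^ n"
  proof (induction n)
    case (Suc n)
    then have "norm (resolvent z0 ((resolvent z0 ^^ n) x)) \<le> norm ((resolvent z0 ^^ n) x) / \<rho>"
      using norm_resolvent_le[OF z0 F _ \<rho> far] by blast
    also have "\<dots> \<le> norm x / \<rho> ^ n / \<rho>" using Suc \<rho> by (intro divide_right_mono) auto
    also have "\<dots> = norm x / \<rho> ^ Suc n" by simp
    finally show ?case using Suc resolvent_orth_to_eigenspaces[OF z0 F] by simp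
  qed (use x in simp)
  then show ?thesis by simp
qed

lemma product_taylor_coeff_eq_remainder_vector:
  "N \<le> n \<Longrightarrow> product_taylor_coeff z0 N q v n = remainder_vector z0 N q v n"
  unfolding product_taylor_coeff_def remainder_vector_def by (intro sum.cong) auto

text \<open>For each \<open>j\<close>, multiplication of the finite expansion of the resolvent by \<open>(z - z0)\<^sup>j\<close>, with
  \<open>M + 1 - j\<close> terms, makes all remainders carry the same power \<open>(z - z0)\<^sup>M\<^sup>+\<^sup>1\<close>.\<close>

lemma product_taylor_remainder:
  assumes z: "z \<notin> spectrum D L" and M: "N \<le> Suc M"
  shows "(\<Sum>j\<le>N. q j * (z - z0) ^ j) *\<^sub>C resolvent z v
      - (\<Sum>n\<le>M. (z - z0) ^ n *\<^sub>C product_taylor_coeff z0 N q v n)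
    = (z - z0) ^ Suc M *\<^sub>C resolvent z (remainder_vector z0 N q v M)"
proof -
  interpret R: bounded_linear "resolvent z" by (rule bounded_linear_resolvent[OF z])
  let ?T = "resolvent z0" and ?w = "z - z0"
  have one: "(q j * ?w ^ j) *\<^sub>C resolvent z v - (\<Sum>n<Suc M. if j \<le> n then (?w ^ n * q j) *\<^sub>C (?T ^^ (Suc n - j)) v else 0)
      = (?w ^ Suc M * q j) *\<^sub>C resolvent z ((?T ^^ (Suc M - j)) v)" if "j \<le> N" for j
  proof -
    have j: "j \<le> Suc M" using that M by simp
    have "(\<Sum>n<Suc M. if j \<le> n then (?w ^ n * q j) *\<^sub>C (?T ^^ (Suc n - j)) v else 0)
        = (\<Sum>i<Suc M - j. (?w ^ (i + j) * q j) *\<^sub>C (?T ^^ (Suc (i + j) - j)) v)"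
      by (rule sum_shifted_coefficients[OF j])
    also have "\<dots> = (\<Sum>i<Suc M - j. (q j * ?w ^ j) *\<^sub>C ?w ^ i *\<^sub>C (?T ^^ Suc i) v)"
    proof (rule sum.cong[OF refl])
      fix i
      have "Suc (i + j) - j = Suc i" by simp
      then show "(?w ^ (i + j) * q j) *\<^sub>C (?T ^^ (Suc (i + j) - j)) v = (q j * ?w ^ j) *\<^sub>C ?w ^ i *\<^sub>C (?T ^^ Suc i) v"
        by (simp only: scaleC_scaleC power_add mult_ac)
    qed
    also have "\<dots> = (q j * ?w ^ j) *\<^sub>C (\<Sum>i<Suc M - j. ?w ^ i *\<^sub>C (?T ^^ Suc i) v)"
      by (simp only: scaleC_sum_right)
    finally have "(q j * ?w ^ j) *\<^sub>C resolvent z v - (\<Sum>n<Suc M. if j \<le> n then (?w ^ n * q j) *\<^sub>C (?T ^^ (Suc n - j)) v else 0)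
        = (q j * ?w ^ j) *\<^sub>C (?w ^ (Suc M - j) *\<^sub>C resolvent z ((?T ^^ (Suc M - j)) v))"
      using resolvent_expansion[OF z, of v "Suc M - j"] by (simp only: flip: scaleC_diff_right) simp
    also have "\<dots> = (?w ^ Suc M * q j) *\<^sub>C resolvent z ((?T ^^ (Suc M - j)) v)"
    proof -
      have "?w ^ j * ?w ^ (Suc M - j) = ?w ^ Suc M" using j by (metis le_add_diff_inverse power_add)
      then have "q j * ?w ^ j * ?w ^ (Suc M - j) = ?w ^ Suc M * q j" by (metis mult.assoc mult.commute)
      then show ?thesis by (simp only: scaleC_scaleC)
    qed
    finally show ?thesis .
  qed
  have "(\<Sum>n\<le>M. ?w ^ n *\<^sub>C product_taylor_coeff z0 N q v n)
      = (\<Sum>n<Suc M. \<Sum>j\<le>N. if j \<le> n then (?w ^ n * q j) *\<^sub>C (?T ^^ (Suc n - j)) v else 0)"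
    unfolding product_taylor_coeff_def scaleC_sum_right lessThan_Suc_atMost
    by (intro sum.cong refl) (simp add: scaleC_scaleC)
  also have "\<dots> = (\<Sum>j\<le>N. \<Sum>n<Suc M. if j \<le> n then (?w ^ n * q j) *\<^sub>C (?T ^^ (Suc n - j)) v else 0)"
    by (rule sum.swap)
  finally have "(\<Sum>j\<le>N. q j * ?w ^ j) *\<^sub>C resolvent z v - (\<Sum>n\<le>M. ?w ^ n *\<^sub>C product_taylor_coeff z0 N q v n)
      = (\<Sum>j\<le>N. (?w ^ Suc M * q j) *\<^sub>C resolvent z ((?T ^^ (Suc M - j)) v))"
    unfolding scaleC_sum_left by (simp only: sum_subtractf[symmetric]) (intro sum.cong refl one, simp)
  also have "\<dots> = ?w ^ Suc M *\<^sub>C resolvent z (remainder_vector z0 N q v M)"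
    unfolding remainder_vector_def R.sum scaleC_sum_right resolvent_scaleC[OF z] scaleC_scaleC ..
  finally show ?thesis .
qed

lemma spectrum_gap: obtains r where "r > 0" "ball z0 r \<inter> spectrum D L = {}"
proof -
  have "finite (spectrum D L \<inter> cball 0 (cmod z0 + 1))" by (rule finite_spectrum_cball)
  from finite_set_avoid[OF this, of z0] obtain d where d: "d > 0"
    "\<And>l. l \<in> spectrum D L \<Longrightarrow> cmod l \<le> cmod z0 + 1 \<Longrightarrow> l \<noteq> z0 \<Longrightarrow> d \<le> dist z0 l" by auto
  have "ball z0 (min d 1) \<inter> spectrum D L = {}"
  proof (rule ccontr)
    assume "\<not> ?thesis"
    then obtain l where l: "dist z0 l < d" "dist z0 l < 1" "l \<in> spectrum D L" by auto
    have "cmod l \<le> cmod z0 + dist z0 l"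
      using norm_triangle_sub[of l z0] by (simp add: dist_norm norm_minus_commute)
    then show False using d(2)[of l] l z0 by auto
  qed
  then show thesis using d(1) that[of "min d 1"] by simp
qed

lemma has_taylor_series_product:
  "has_taylor_series (\<lambda>z. (\<Sum>j\<le>N. q j * (z - z0) ^ j) *\<^sub>C resolvent z v) z0 (product_taylor_coeff z0 N q v)"
proof -
  interpret T: bounded_linear "resolvent z0" by (rule bounded_linear_resolvent[OF z0])
  obtain B0 where B0: "\<And>x. norm (resolvent z0 x) \<le> norm x * B0" using T.bounded by blast
  define B where "B = max 1 B0"
  have B: "B \<ge> 1" by (simp add: B_def)
  have B_bound: "norm (resolvent z0 x) \<le> B * norm x" for x
    using B0[of x] mult_left_mono[of B0 B "norm x"] by (simp add: B_def mult.commute)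
  have power_bound: "norm ((resolvent z0 ^^ n) v) \<le> B ^ n * norm v" for n
  proof (induction n)
    case (Suc n)
    have "norm ((resolvent z0 ^^ Suc n) v) \<le> B * norm ((resolvent z0 ^^ n) v)" using B_bound by simp
    also have "\<dots> \<le> B * (B ^ n * norm v)" using Suc B by (intro mult_left_mono) auto
    finally show ?case by (simp add: mult.assoc)
  qed simp
  define C where "C = (\<Sum>j\<le>N. cmod (q j)) * norm v"
  have remainder_bound: "norm (remainder_vector z0 N q v M) \<le> C * B ^ Suc M" for M
  proof -
    have "norm (remainder_vector z0 N q v M) \<le> (\<Sum>j\<le>N. cmod (q j) * (B ^ Suc M * norm v))"
      unfolding remainder_vector_def
    proof (rule sum_norm_le)
      fix j
      have "norm ((resolvent z0 ^^ (Suc M - j)) v) \<le> B ^ (Suc M - j) * norm v" by (rule power_bound)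
      also have "\<dots> \<le> B ^ Suc M * norm v" using B by (intro mult_right_mono power_increasing) auto
      finally show "norm (q j *\<^sub>C (resolvent z0 ^^ (Suc M - j)) v) \<le> cmod (q j) * (B ^ Suc M * norm v)"
        by (simp add: mult_left_mono)
    qed
    then show ?thesis by (simp add: C_def sum_distrib_right sum_distrib_left mult_ac)
  qed
  obtain r0 where r0: "r0 > 0" "ball z0 r0 \<inter> spectrum D L = {}" by (rule spectrum_gap)
  have "(\<lambda>n. (z - z0) ^ n *\<^sub>C product_taylor_coeff z0 N q v n) sums ((\<Sum>j\<le>N. q j * (z - z0) ^ j) *\<^sub>C resolvent z v)"
    if z: "z \<in> ball z0 (min r0 (1 / B))" for z
  proof -
    let ?w = "z - z0"
    have zS: "z \<notin> spectrum D L" using z r0 by auto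
    have w: "cmod ?w < 1 / B" using z by (simp add: dist_norm norm_minus_commute)
    interpret R: bounded_linear "resolvent z" by (rule bounded_linear_resolvent[OF zS])
    obtain K where K: "K \<ge> 0" "\<And>x. norm (resolvent z x) \<le> norm x * K" using R.nonneg_bounded by blast
    define x where "x = cmod ?w * B"
    have x: "0 \<le> x" "x < 1" using w B by (auto simp: x_def pos_less_divide_eq)
    have "(\<lambda>M. K * C * x ^ Suc M) \<longlonglongrightarrow> K * C * 0"
      using x by (intro tendsto_mult tendsto_const LIMSEQ_Suc LIMSEQ_realpow_zero)
    then have lim: "(\<lambda>M. K * C * x ^ Suc M) \<longlonglongrightarrow> 0" by simp
    have "(\<lambda>M. (\<Sum>j\<le>N. q j * ?w ^ j) *\<^sub>C resolvent z v - (\<Sum>n\<le>M. ?w ^ n *\<^sub>C product_taylor_coeff z0 N q v n)) \<longlonglongrightarrow> 0"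
    proof (rule Lim_null_comparison[OF _ lim], rule eventually_sequentiallyI[of N])
      fix M assume "N \<le> M"
      then have "norm ((\<Sum>j\<le>N. q j * ?w ^ j) *\<^sub>C resolvent z v - (\<Sum>n\<le>M. ?w ^ n *\<^sub>C product_taylor_coeff z0 N q v n))
          = cmod ?w ^ Suc M * norm (resolvent z (remainder_vector z0 N q v M))"
        using product_taylor_remainder[OF zS, of N M q v] by (simp only: norm_scaleC norm_power)
      also have "\<dots> \<le> cmod ?w ^ Suc M * (C * B ^ Suc M * K)"
        using order_trans[OF K(2) mult_right_mono[OF remainder_bound K(1)]] by (intro mult_left_mono) auto
      also have "\<dots> = K * C * x ^ Suc M" by (simp add: x_def power_mult_distrib)
      finally show "norm ((\<Sum>j\<le>N. q j * ?w ^ j) *\<^sub>C resolvent z v - (\<Sum>n\<le>M. ?w ^ n *\<^sub>C product_taylor_coeff z0 N q v n))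
          \<le> K * C * x ^ Suc M" .
    qed
    from tendsto_diff[OF tendsto_const this, of "(\<Sum>j\<le>N. q j * ?w ^ j) *\<^sub>C resolvent z v"]
    show ?thesis unfolding sums_def_le by simp
  qed
  moreover have "min r0 (1 / B) > 0" using r0 B by simp
  ultimately show ?thesis unfolding has_taylor_series_def by blast
qed

lemma taylor_coeff_product:
  "taylor_coeff (\<lambda>z. (\<Sum>j\<le>N. q j * (z - z0) ^ j) *\<^sub>C solution_map D L v z) n z0 = product_taylor_coeff z0 N q v n"
  using taylor_coeff_eqI[OF has_taylor_series_product] by (simp add: resolvent_def)

text \<open>The \<open>g\<^sub>j\<close> are the coefficients of \<open>\<Prod>\<^sub>l (w - (l - z0))\<close> over \<open>l \<in> F\<close>, so that the sum is
  \<open>\<Prod>\<^sub>l (1 - (l - z0) T) v\<close> for the resolvent \<open>T\<close> at \<open>z0\<close>. On the eigenspace for \<open>l\<close>, where \<open>T\<close> is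
  multiplication by \<open>1 / (l - z0)\<close>, the factor for \<open>l\<close> vanishes.\<close>

lemma annihilating_polynomial:
  assumes "finite F" "F \<subseteq> spectrum D L"
  shows "\<exists>g. g (card F) = 1 \<and>
    (\<Sum>j\<le>card F. g j *\<^sub>C (resolvent z0 ^^ (card F - j)) v) \<in> orth_to_eigenspaces F"
  using assms
proof (induction F)
  case empty
  then show ?case by (intro exI[of _ "\<lambda>_. 1"]) (simp add: orth_to_eigenspaces_def)
next
  case (insert l F)
  obtain T' where "compact_normal (resolvent z0) T'" by (rule obtain_adjoint_of_resolvent[OF z0])
  then interpret T: compact_normal "resolvent z0" T' .
  let ?N = "card F" and ?T = "resolvent z0"
  obtain g where g: "g ?N = 1" and u: "(\<Sum>j\<le>?N. g j *\<^sub>C (?T ^^ (?N - j)) v) \<in> orth_to_eigenspaces F"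
    using insert by auto
  define u where "u = (\<Sum>j\<le>?N. g j *\<^sub>C (?T ^^ (?N - j)) v)"
  define \<mu> where "\<mu> = l - z0"
  have \<mu>: "\<mu> \<noteq> 0" using insert.prems z0 by (auto simp: \<mu>_def)
  \<comment> \<open>The coefficients of \<open>(w - \<mu>) * (\<Sum>j\<le>card F. g\<^sub>j w\<^sup>j)\<close>.\<close>
  define g' where "g' j = (case j of 0 \<Rightarrow> 0 | Suc i \<Rightarrow> g i) - (if j \<le> ?N then \<mu> * g j else 0)" for j
  have card: "card (insert l F) = Suc ?N" using insert by simp
  have "(\<Sum>j\<le>Suc ?N. (case j of 0 \<Rightarrow> 0 | Suc i \<Rightarrow> g i) *\<^sub>C (?T ^^ (Suc ?N - j)) v) = u"
    by (subst sum.atMost_Suc_shift) (simp add: u_def)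
  moreover have "(\<Sum>j\<le>Suc ?N. (if j \<le> ?N then \<mu> * g j else 0) *\<^sub>C (?T ^^ (Suc ?N - j)) v) = \<mu> *\<^sub>C ?T u"
    unfolding u_def T.T.sum scaleC_sum_right T.scaleC
    by (simp add: scaleC_scaleC) (intro sum.cong refl, simp add: Suc_diff_le)
  ultimately have g'_sum: "(\<Sum>j\<le>Suc ?N. g' j *\<^sub>C (?T ^^ (Suc ?N - j)) v) = u - \<mu> *\<^sub>C ?T u"
    unfolding g'_def scaleC_diff_left sum_subtractf by simp
  have "u - \<mu> *\<^sub>C ?T u \<in> orth_to_eigenspaces (insert l F)"
  proof -
    have "cinner (u - \<mu> *\<^sub>C ?T u) e = 0" if k: "k \<in> insert l F" "e \<in> eigenspace D L k" for k e
    proof (cases "k = l")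
      case True
      have "?T e = (1 / (l - z0)) *\<^sub>C e" using k True insert.prems by (intro resolvent_eigenvector[OF z0]) auto
      from T.eigenvector_adjoint[OF this] show ?thesis
        using \<mu> by (simp add: cinner_algebra T.adjoint flip: \<mu>_def)
    next
      case False
      then have "k \<in> F" using k by simp
      moreover have "?T u \<in> orth_to_eigenspaces F"
        using insert.prems u by (intro resolvent_orth_to_eigenspaces[OF z0]) (auto simp: u_def)
      ultimately show ?thesis using u k by (simp add: orth_to_eigenspaces_def cinner_algebra flip: u_def)
    qed
    then show ?thesis unfolding orth_to_eigenspaces_def by blast
  qed
  moreover have "g' (Suc ?N) = 1" using g by (simp add: g'_def)
  ultimately show ?case unfolding card using g'_sum by (intro exI[of _ g']) simp
qed

text \<open>Take the annihilating polynomial of \<open>F\<close>, scaled to unit length. Its remainder vector is a fixed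
  multiple of \<open>T\<^sup>n\<^sup>+\<^sup>1\<^sup>-\<^sup>N u\<close> with \<open>u\<close> orthogonal to the eigenspaces for \<open>F\<close>, where the norm of \<open>T\<close>
  is at most \<open>1 / \<rho>\<close>.\<close>

lemma exists_small_remainder_vector:
  assumes F: "finite F" "F \<subseteq> spectrum D L"
    and \<rho>: "\<rho> > 0" and far: "\<And>l. l \<in> spectrum D L - F \<Longrightarrow> \<rho> \<le> cmod (l - z0)"
  shows "\<exists>q C. (\<Sum>j\<le>card F. (cmod (q j))\<^sup>2) = 1 \<and>
    (\<forall>n\<ge>card F. norm (remainder_vector z0 (card F) q v n) \<le> C / \<rho> ^ n)"
proof -
  let ?N = "card F" and ?T = "resolvent z0"
  interpret T: bounded_linear ?T by (rule bounded_linear_resolvent[OF z0])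
  obtain g where g: "g ?N = 1" and u: "(\<Sum>j\<le>?N. g j *\<^sub>C (?T ^^ (?N - j)) v) \<in> orth_to_eigenspaces F"
    using annihilating_polynomial[OF F] by blast
  define u where "u = (\<Sum>j\<le>?N. g j *\<^sub>C (?T ^^ (?N - j)) v)"
  define s where "s = (\<Sum>j\<le>?N. (cmod (g j))\<^sup>2)"
  have "s \<ge> (cmod (g ?N))\<^sup>2" unfolding s_def by (rule member_le_sum) auto
  then have s: "s > 0" using g by simp
  define q where "q j = complex_of_real (1 / sqrt s) * g j" for j
  have "(\<Sum>j\<le>?N. (cmod (q j))\<^sup>2) = (\<Sum>j\<le>?N. 1 / s * (cmod (g j))\<^sup>2)"
    using s by (intro sum.cong refl) (simp add: q_def norm_divide power_divide)
  also have "\<dots> = 1" using s by (simp add: s_def flip: sum_divide_distrib)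
  finally have unit: "(\<Sum>j\<le>?N. (cmod (q j))\<^sup>2) = 1" .
  have "norm (remainder_vector z0 ?N q v n) \<le> (1 / sqrt s * norm u * \<rho> ^ ?N / \<rho>) / \<rho> ^ n" if n: "?N \<le> n" for n
  proof -
    define m where "m = Suc n - ?N"
    have power_T: "(?T ^^ m) (\<Sum>j\<in>A. a j *\<^sub>C x j) = (\<Sum>j\<in>A. a j *\<^sub>C (?T ^^ m) (x j))"
      for m A and a :: "nat \<Rightarrow> complex" and x
      by (induction m) (simp_all add: T.sum resolvent_scaleC[OF z0])
    have "remainder_vector z0 ?N q v n = complex_of_real (1 / sqrt s) *\<^sub>C (?T ^^ m) u"
      unfolding remainder_vector_def u_def power_T scaleC_sum_right
    proof (intro sum.cong refl)
      fix j assume "j \<in> {..?N}"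
      then have "Suc n - j = m + (?N - j)" using n by (simp add: m_def)
      then show "q j *\<^sub>C (?T ^^ (Suc n - j)) v = complex_of_real (1 / sqrt s) *\<^sub>C g j *\<^sub>C (?T ^^ m) ((?T ^^ (?N - j)) v)"
        by (simp add: q_def scaleC_scaleC funpow_add)
    qed
    then have "norm (remainder_vector z0 ?N q v n) = 1 / sqrt s * norm ((?T ^^ m) u)"
      using s by (simp add: norm_divide)
    also have "\<dots> \<le> 1 / sqrt s * (norm u / \<rho> ^ m)"
      using s norm_resolvent_power_le[OF F(2) u \<rho> far] by (intro mult_left_mono) (auto simp: u_def)
    also have "\<rho> ^ m = \<rho> ^ Suc n / \<rho> ^ ?N" using n \<rho> by (simp add: m_def power_diff del: power_Suc)
    finally show ?thesis using \<rho> by (simp add: mult_ac)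
  qed
  with unit show ?thesis by blast
qed

end

lemma fast_LS_Pade_error:
  assumes z0: "z0 \<notin> spectrum D L" and z: "z \<notin> spectrum D L" and N: "N \<le> Suc M"
    and Q: "Q = (\<lambda>z. \<Sum>j\<le>N. q j * (z - z0) ^ j)" and Qz: "Q z \<noteq> 0"
  shows "solution_map D L v z - fast_LS_Pade (solution_map D L v) z0 M Q z
    = ((z - z0) ^ Suc M / Q z) *\<^sub>C resolvent z (remainder_vector z0 N q v M)"
proof -
  have coeff: "taylor_coeff (\<lambda>w. Q w *\<^sub>C solution_map D L v w) n z0 = product_taylor_coeff z0 N q v n" for n
    unfolding Q by (rule taylor_coeff_product[OF z0])
  have "solution_map D L v z - fast_LS_Pade (solution_map D L v) z0 M Q z
      = inverse (Q z) *\<^sub>C (Q z *\<^sub>C resolvent z v - (\<Sum>n\<le>M. (z - z0) ^ n *\<^sub>C product_taylor_coeff z0 N q v n))"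
    using Qz by (simp add: fast_LS_Pade_def fast_LS_Pade_numerator_def coeff resolvent_def
        scaleC_diff_right scaleC_scaleC)
  also have "\<dots> = inverse (Q z) *\<^sub>C (z - z0) ^ Suc M *\<^sub>C resolvent z (remainder_vector z0 N q v M)"
    using product_taylor_remainder[OF z0 z N, of q v] by (simp add: Q)
  finally show ?thesis by (simp only: scaleC_scaleC divide_inverse mult.commute)
qed

lemma fast_functional_eq:
  assumes z0: "z0 \<notin> spectrum D L" and "N \<le> E"
  shows "fast_functional (solution_map D L v) z0 E (\<lambda>z. \<Sum>j\<le>N. q j * (z - z0) ^ j)
    = norm (remainder_vector z0 N q v E)"
  unfolding fast_functional_def taylor_coeff_product[OF z0]
  by (simp add: product_taylor_coeff_eq_remainder_vector[OF z0 assms(2)])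

text \<open>For \<open>M \<ge> N\<close> the parameter of the functional is \<open>M\<close>, and the functional is then the norm of the
  remainder vector. A minimiser does at least as well as the annihilating polynomial.\<close>

lemma minimizer_remainder_vector_bound:
  assumes z0: "z0 \<notin> spectrum D L"
    and F: "finite F" "F \<subseteq> spectrum D L"
    and \<rho>: "\<rho> > 0" and far: "\<And>l. l \<in> spectrum D L - F \<Longrightarrow> \<rho> \<le> cmod (l - z0)"
  obtains C where "\<And>M q. card F \<le> M \<Longrightarrow>
      fast_LS_Pade_denominator (solution_map D L v) z0 M (card F) M (\<lambda>z. \<Sum>j\<le>card F. q j * (z - z0) ^ j) \<Longrightarrow>
      norm (remainder_vector z0 (card F) q v M) \<le> C / \<rho> ^ M"
proof -
  obtain q0 C where q0: "(\<Sum>j\<le>card F. (cmod (q0 j))\<^sup>2) = 1"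
    and C: "\<And>n. n \<ge> card F \<Longrightarrow> norm (remainder_vector z0 (card F) q0 v n) \<le> C / \<rho> ^ n"
    using exists_small_remainder_vector[OF z0 F \<rho> far] by blast
  have "norm (remainder_vector z0 (card F) q v M) \<le> C / \<rho> ^ M"
    if M: "card F \<le> M"
      and min: "fast_LS_Pade_denominator (solution_map D L v) z0 M (card F) M (\<lambda>z. \<Sum>j\<le>card F. q j * (z - z0) ^ j)"
    for M q
  proof -
    have "(\<lambda>z. \<Sum>j\<le>card F. q0 j * (z - z0) ^ j) \<in> unit_polys (card F) z0"
      using q0 unfolding unit_polys_def by blast
    then have "norm (remainder_vector z0 (card F) q v M) \<le> norm (remainder_vector z0 (card F) q0 v M)"
      using min unfolding fast_LS_Pade_denominator_def is_arg_min_def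
      by (metis (no_types, lifting) fast_functional_eq[OF z0 M] not_le)
    then show ?thesis using C[OF M] by simp
  qed
  then show thesis using that by blast
qed

end

section \<open>Convergence of the approximants\<close>

theorem corollary6p4:
  fixes D :: "'v::complex_hilbert set"
    and L :: "'v \<Rightarrow> 'v"
    and vstar :: 'v
    and lam :: "nat \<Rightarrow> complex"
    and z0 :: complex
    and R \<delta> :: real
    and Nbar Nstar :: nat
    and M :: "nat \<Rightarrow> nat"
    and Q :: "nat \<Rightarrow> complex \<Rightarrow> complex"
    and S :: "complex \<Rightarrow> 'v"
  assumes separable: "separable_space (euclidean :: 'v topology)"
    and linear: "complex_linear_on D L"
    and dense: "closure D = UNIV"
    and bijective: "bij_betw L D UNIV"
    and compact_inverse: "compact_operator (inv_into D L)"
    and normal_inverse: "normal_operator (inv_into D L)"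
    and infinite_spectrum: "infinite (spectrum D L)"
    and nonzero_residues:
      "\<And>l. l \<in> spectrum D L \<Longrightarrow> orth_proj (eigenspace D L l) vstar \<noteq> 0"
    and enumeration: "bij_betw lam {1..} (spectrum D L)"
    and ordering: "\<And>\<alpha>. \<alpha> \<ge> 1 \<Longrightarrow> cmod (lam \<alpha> - z0) \<le> cmod (lam (\<alpha> + 1) - z0)"
    and S_eq: "S = solution_map D L vstar"
    and z0: "z0 \<notin> spectrum D L"
    and R: "R > 0"
    and no_pole_on_circle: "\<And>p. p \<in> sphere z0 R \<Longrightarrow> \<not> is_pole S p"
    and Nbar: "Nbar = card {p \<in> ball z0 R. is_pole S p}"
    and Nstar: "Nstar \<ge> Nbar"
    and M_ge: "\<And>k. k \<ge> 1 \<Longrightarrow> int (M k) \<ge> int Nstar - 1"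
    and M_increasing: "\<And>k. k \<ge> 1 \<Longrightarrow> M (k + 1) > M k"
    and Q: "\<And>k. k \<ge> 1 \<Longrightarrow>
      fast_LS_Pade_denominator S z0 (M k) Nstar (max (M k) Nstar) (Q k)"
    and \<delta>: "\<delta> > 0"
  shows "\<exists>C :: real. \<exists>E :: nat \<Rightarrow> complex set.
    \<forall>k\<ge>1. E k \<in> sets lebesgue \<and> emeasure lebesgue (E k) \<le> ennreal \<delta> \<and>
      (\<forall>z \<in> ball z0 R - E k.
         z \<notin> spectrum D L \<and> Q k z \<noteq> 0 \<and>
         norm (S z - fast_LS_Pade S z0 (M k) (Q k) z)
           \<le> C * (cmod ((z - z0) / (lam (Nstar + 1) - z0))) ^ M k)"
proof -
  interpret normal_resolvent D L
    by (rule normal_resolvent.intro[OF linear bijective compact_inverse normal_inverse])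
  define F where "F = lam ` {1..Nstar}"
  define \<rho> where "\<rho> = cmod (lam (Nstar + 1) - z0)"
  have lam: "lam \<alpha> \<in> spectrum D L" if "\<alpha> \<ge> 1" for \<alpha>
    using bij_betwE[OF enumeration] that by simp
  have F: "finite F" "F \<subseteq> spectrum D L" using lam by (auto simp: F_def)
  have card_F: "card F = Nstar"
  proof -
    have "inj_on lam {1..Nstar}"
      using enumeration by (auto simp: bij_betw_def intro: inj_on_subset)
    then show ?thesis by (simp add: F_def card_image)
  qed
  have \<rho>: "\<rho> > 0" using lam[of "Nstar + 1"] z0 by (auto simp: \<rho>_def)
  have far: "\<rho> \<le> cmod (l - z0)" if l: "l \<in> spectrum D L - F" for l
  proof -
    obtain \<alpha> where \<alpha>: "\<alpha> \<ge> 1" "l = lam \<alpha>"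
      using l bij_betw_imp_surj_on[OF enumeration] by auto
    then have "Nstar + 1 \<le> \<alpha>" using l by (force simp: F_def)
    then have "cmod (lam (Nstar + 1) - z0) \<le> cmod (lam \<alpha> - z0)"
    proof (induction \<alpha> rule: dec_induct)
      case (step n)
      then show ?case using ordering[of n] by simp
    qed simp
    then show ?thesis by (simp add: \<rho>_def \<alpha>)
  qed

  have "\<exists>q. Q k = (\<lambda>z. \<Sum>j\<le>Nstar. q j * (z - z0) ^ j) \<and> (\<Sum>j\<le>Nstar. (cmod (q j))\<^sup>2) = 1" if "k \<ge> 1" for k
    using Q[OF that] by (auto simp: fast_LS_Pade_denominator_def is_arg_min_def unit_polys_def)
  then obtain q where Q_eq: "\<And>k. k \<ge> 1 \<Longrightarrow> Q k = (\<lambda>z. \<Sum>j\<le>Nstar. q k j * (z - z0) ^ j)"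
    and q_unit: "\<And>k. k \<ge> 1 \<Longrightarrow> (\<Sum>j\<le>Nstar. (cmod (q k j))\<^sup>2) = 1"
    by metis
  define U where "U k = remainder_vector z0 Nstar (q k) vstar (M k)" for k
  obtain C0 where C0: "\<And>M q. card F \<le> M \<Longrightarrow>
      fast_LS_Pade_denominator (solution_map D L vstar) z0 M (card F) M (\<lambda>z. \<Sum>j\<le>card F. q j * (z - z0) ^ j) \<Longrightarrow>
      norm (remainder_vector z0 (card F) q vstar M) \<le> C0 / \<rho> ^ M"
    using minimizer_remainder_vector_bound[OF z0 F \<rho> far] by blast
  define C1 where "C1 = max C0 (norm (U 1) * \<rho> ^ M 1)"
  have C1: "C1 \<ge> 0" "C0 \<le> C1" "norm (U 1) * \<rho> ^ M 1 \<le> C1"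
  proof -
    show "C0 \<le> C1" and le: "norm (U 1) * \<rho> ^ M 1 \<le> C1"
      unfolding C1_def by (rule max.cobounded1, rule max.cobounded2)
    have "0 \<le> norm (U 1) * \<rho> ^ M 1" using \<rho> by simp
    then show "C1 \<ge> 0" using le by linarith
  qed
  \<comment> \<open>\<open>M k = Nstar - 1\<close> is possible for \<open>k = 1\<close> only; then the functional that \<open>Q k\<close> minimises
    is not the norm of \<open>U k\<close>, but a single index is absorbed into the constant.\<close>
  have U_bound: "norm (U k) \<le> C1 / \<rho> ^ M k" if k: "k \<ge> 1" for k
  proof (cases "k = 1")
    case True
    then show ?thesis using C1(3) \<rho> by (simp add: pos_le_divide_eq)
  next
    case False
    then have "M (k - 1 + 1) > M (k - 1)" "int (M (k - 1)) \<ge> int Nstar - 1"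
      using k by (intro M_increasing M_ge; simp)+
    then have N: "Nstar \<le> M k" using k by simp
    then have "fast_LS_Pade_denominator (solution_map D L vstar) z0 (M k) (card F) (M k)
        (\<lambda>z. \<Sum>j\<le>card F. q k j * (z - z0) ^ j)"
      using Q[OF k] by (simp add: S_eq Q_eq[OF k] card_F max_def split: if_splits)
    then have "norm (U k) \<le> C0 / \<rho> ^ M k" unfolding U_def using C0 N card_F by metis
    also have "\<dots> \<le> C1 / \<rho> ^ M k" using C1 \<rho> by (intro divide_right_mono) auto
    finally show ?thesis .
  qed

  \<comment> \<open>With discs of radius \<open>\<eta> \<le> 1\<close>, only points of the spectrum in \<open>ball z0 (R + 1)\<close> come within
    distance \<open>\<eta>\<close> of the ball.\<close>
  define P where "P = spectrum D L \<inter> ball z0 (R + 1)"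
  have P: "finite P"
  proof (rule finite_subset)
    show "P \<subseteq> spectrum D L \<inter> cball 0 (cmod z0 + (R + 1))"
    proof
      fix l assume "l \<in> P"
      then show "l \<in> spectrum D L \<inter> cball 0 (cmod z0 + (R + 1))"
        using norm_triangle_sub[of l z0] by (auto simp: P_def dist_norm norm_minus_commute)
    qed
  qed (rule finite_spectrum_cball)
  define K where "K = Nstar + card P"
  define \<eta> where "\<eta> = min 1 (sqrt (\<delta> / (real (Suc K) * pi)))"
  have \<eta>: "\<eta> > 0" using \<delta> by (simp add: \<eta>_def)
  have \<eta>_le: "\<eta> \<le> 1" unfolding \<eta>_def by (rule min.cobounded1)
  have \<eta>_area: "real K * (pi * \<eta>\<^sup>2) \<le> \<delta>"
  proof -
    have "\<eta>\<^sup>2 \<le> (sqrt (\<delta> / (real (Suc K) * pi)))\<^sup>2"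
      using \<eta> by (intro power_mono) (auto simp: \<eta>_def)
    also have "\<dots> = \<delta> / (real (Suc K) * pi)" using \<delta> by simp
    finally have "real (Suc K) * pi * \<eta>\<^sup>2 \<le> \<delta>" by (simp add: pos_le_divide_eq mult.commute del: of_nat_Suc)
    moreover have "real K * (pi * \<eta>\<^sup>2) \<le> real (Suc K) * (pi * \<eta>\<^sup>2)" by (intro mult_right_mono) auto
    ultimately show ?thesis by (simp only: mult.assoc)
  qed

  obtain c where c: "c > 0" and lower: "\<And>p :: complex poly. degree p \<le> Nstar \<Longrightarrow>
      \<exists>Z. finite Z \<and> card Z \<le> Nstar \<and> (\<forall>w j. cmod w < R \<longrightarrow> (\<forall>r\<in>Z. \<eta> \<le> cmod (w - r))
        \<longrightarrow> c * cmod (coeff p j) \<le> cmod (poly p w))"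
    using poly_lower_bound_off_discs[OF R \<eta>, of Nstar] by blast
  define p where "p k = (\<Sum>j\<le>Nstar. monom (q k j) j)" for k
  have "degree (p k) \<le> Nstar" for k
    unfolding p_def by (intro degree_sum_le) (auto intro: order_trans[OF degree_monom_le])
  then have "\<forall>k. \<exists>Z. finite Z \<and> card Z \<le> Nstar \<and> (\<forall>w j. cmod w < R \<longrightarrow> (\<forall>r\<in>Z. \<eta> \<le> cmod (w - r))
      \<longrightarrow> c * cmod (coeff (p k) j) \<le> cmod (poly (p k) w))"
    using lower by blast
  then obtain Z where Z: "\<And>k. finite (Z k)" "\<And>k. card (Z k) \<le> Nstar"
    and Z_lower: "\<And>k w j. cmod w < R \<Longrightarrow> (\<forall>r\<in>Z k. \<eta> \<le> cmod (w - r)) \<Longrightarrow>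
      c * cmod (coeff (p k) j) \<le> cmod (poly (p k) w)"
    by metis
  define A where "A k = (\<lambda>r. z0 + r) ` Z k \<union> P" for k
  define E where "E k = (\<Union>x\<in>A k. ball x \<eta>)" for k
  define b where "b = c / real (Suc Nstar)"
  have b: "b > 0" using c by (simp add: b_def)

  have "E k \<in> sets lebesgue \<and> emeasure lebesgue (E k) \<le> ennreal \<delta> \<and>
      (\<forall>z \<in> ball z0 R - E k. z \<notin> spectrum D L \<and> Q k z \<noteq> 0 \<and>
         norm (S z - fast_LS_Pade S z0 (M k) (Q k) z)
           \<le> R * C1 / (b * \<eta>) * (cmod ((z - z0) / (lam (Nstar + 1) - z0))) ^ M k)"
    if k: "k \<ge> 1" for k
  proof (intro conjI ballI)
    have "open (E k)" by (auto simp: E_def)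
    then show "E k \<in> sets lebesgue" by simp
    have "finite (A k)" using Z(1)[of k] P by (simp add: A_def)
    moreover have "card (A k) \<le> K"
      unfolding A_def K_def
      using card_Un_le[of "(\<lambda>r. z0 + r) ` Z k" P] card_image_le[OF Z(1)[of k], of "\<lambda>r. z0 + r"] Z(2)[of k]
      by linarith
    ultimately show "emeasure lebesgue (E k) \<le> ennreal \<delta>"
      unfolding E_def using \<eta> \<eta>_area by (intro emeasure_discs_le) auto
    fix z assume z: "z \<in> ball z0 R - E k"
    let ?w = "z - z0"
    have w: "cmod ?w < R" using z by (simp add: dist_norm norm_minus_commute)
    have away: "\<eta> \<le> cmod (l - z)" if l: "l \<in> spectrum D L" for l
    proof (cases "l \<in> P")
      case True
      then have "z \<notin> ball l \<eta>" using z by (auto simp: E_def A_def)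
      then show ?thesis by (simp add: dist_norm)
    next
      case False
      then have "R + 1 \<le> cmod (l - z0)" using l by (simp add: P_def dist_norm norm_minus_commute)
      also have "\<dots> \<le> cmod (l - z) + cmod ?w" using norm_triangle_ineq[of "l - z" ?w] by simp
      finally show ?thesis using w \<eta>_le by linarith
    qed
    show zS: "z \<notin> spectrum D L" using away[of z] \<eta> by auto
    have "\<eta> \<le> cmod (?w - r)" if "r \<in> Z k" for r
    proof -
      have "z \<notin> ball (z0 + r) \<eta>" using z that by (auto simp: E_def A_def)
      then show ?thesis by (simp add: dist_norm norm_minus_commute algebra_simps)
    qed
    then have pk: "c * cmod (coeff (p k) j) \<le> cmod (poly (p k) ?w)" for j
      by (intro Z_lower w) blast
    obtain j where j: "j \<le> Nstar" "1 / real (Suc Nstar) \<le> cmod (q k j)"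
      by (rule unit_coefficients_lower_bound[OF q_unit[OF k]])
    have "b \<le> c * cmod (q k j)" using mult_left_mono[OF j(2), of c] c by (simp add: b_def)
    also have "q k j = coeff (p k) j" using j(1) by (simp add: p_def coeff_sum)
    also have "c * cmod (coeff (p k) j) \<le> cmod (poly (p k) ?w)" by (rule pk)
    also have "poly (p k) ?w = Q k z" by (simp add: p_def poly_sum poly_monom Q_eq[OF k])
    finally have Q_lower: "b \<le> cmod (Q k z)" .
    then show Qz: "Q k z \<noteq> 0" using b by auto
    have res: "norm (resolvent z x) \<le> norm x / \<eta>" for x
      by (rule norm_resolvent_le[OF zS, of "{}"]) (use away \<eta> in \<open>auto simp: orth_to_eigenspaces_def\<close>)
    have "Nstar \<le> Suc (M k)" using M_ge[OF k] by linarith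
    then have "norm (S z - fast_LS_Pade S z0 (M k) (Q k) z)
        = cmod ?w ^ Suc (M k) / cmod (Q k z) * norm (resolvent z (U k))"
      unfolding S_eq U_def
      by (simp only: fast_LS_Pade_error[OF z0 zS _ Q_eq[OF k] Qz] norm_scaleC norm_divide norm_power)
    also have "\<dots> \<le> (R * cmod ?w ^ M k) / b * (C1 / \<rho> ^ M k / \<eta>)"
    proof (rule mult_mono)
      have "cmod ?w ^ Suc (M k) \<le> R * cmod ?w ^ M k" using w by (simp add: mult_right_mono)
      then show "cmod ?w ^ Suc (M k) / cmod (Q k z) \<le> (R * cmod ?w ^ M k) / b"
        using Q_lower b R by (intro frac_le) auto
      show "norm (resolvent z (U k)) \<le> C1 / \<rho> ^ M k / \<eta>"
        using res[of "U k"] divide_right_mono[OF U_bound[OF k], of \<eta>] \<eta> by simp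
    qed (use R b in auto)
    also have "\<dots> = R * C1 / (b * \<eta>) * (cmod (?w / (lam (Nstar + 1) - z0))) ^ M k"
      by (simp add: norm_divide power_divide \<rho>_def mult_ac)
    finally show "norm (S z - fast_LS_Pade S z0 (M k) (Q k) z)
        \<le> R * C1 / (b * \<eta>) * (cmod (?w / (lam (Nstar + 1) - z0))) ^ M k" .
  qed
  then show ?thesis by blast
qed

end
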